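(* Every $(0,3,6)$-fullerene is isomorphic (as a plane graph) to a graph $G$ produced by the following construction. Let $\mathcal T$ be the infinite regular triangular grid in the Euclidean plane, whose vertices (gridpoints) are the points of the $A_2$ lattice $\{i\mathbf a + j\mathbf b : i,j\in\mathbb Z\}$, where $\mathbf a,\mathbf b$ are unit vectors with angle $\pi/3$ between them, and whose edges join gridpoints at distance $1$; the midpoint of an edge of $\mathcal T$ is called an edgepoint. (1) Choose a (nondegenerate) triangle $\triangle ABC$ with no obtuse angle whose vertices are gridpoints of $\mathcal T$, and let $\bar A,\bar B,\bar C$ be the midpoints of the sides opposite $A,B,C$ respectively. (2) Optionally, translate $\triangle ABC$ (together with $\bar A,\bar B,\bar C$), keeping $\mathcal T$ fixed, so that $A$ coincides with an edgepoint of $\mathcal T$. (3) Fold $\triangle ABC$ into the isosceles tetrahedron $Q=A\bar A\bar B\bar C$ by identifying the boundary segment $\bar A B$ with $\bar A C$, $\bar B C$ with $\bar B A$, and $\bar C A$ with $\bar C B$ (so $A,B,C$ become a single vertex of $Q$). The portion of $\mathcal T$ lying within $\triangle ABC$ becomes a finite graph $G^*$ drawn on the surface of $Q$ (which is a sphere), possibly with semiedges (an edge of $\mathcal T$ whose midpoint is one of the corners $A,\bar A,\bar B,\bar C$ becomes a semiedge). (4) Let $G$ be the plane dual of $G^*$.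
   Context: Graphs may have multiple edges and semiedges. A semiedge is an edge with only one endpoint; it contributes one to the degree of its endpoint, and in a plane embedding a semiedge with endpoint $v$ drawn inside a face $f$ contributes one to the size of $f$. A $(0,3,6)$-fullerene is a cubic plane graph, possibly with semiedges, all of whose faces have size $3$ or $6$. The dual of a plane graph with semiedges is the usual plane dual, extended so that every semiedge incident with vertex $v$ and face $f$ corresponds to a semiedge of the dual incident with the dual vertex $f^*$ and lying in the dual face $v^*$.
   Formalization: The (0,3,6)-fullerene is assumed to be connected; without this the claim fails, e.g. for two disjoint copies of K4 drawn side by side, whose common face has size 6, since the construction only produces connected graphs. *)

theory Defs
  imports "HOL-Analysis.Analysis" "HOL-Combinatorics.Orbits"
begin

text \<open>
  Plane graphs with semiedges are represented by rotation systems. A dart is an end of an edge: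
  an ordinary edge has two darts, a semiedge has one. The map \<open>rot\<close> sends a dart to the next
  one in counterclockwise order around the same endpoint; \<open>opp\<close> exchanges the two darts of an
  edge and fixes the dart of a semiedge.
\<close>

record 'd dart_graph =
  darts :: "'d set"
  rot :: "'d \<Rightarrow> 'd"
  opp :: "'d \<Rightarrow> 'd"

text \<open>
  Walking along a dart with the face on the left, one arrives at the endpoint of the opposite dart
  and continues along the clockwise next dart there. At a semiedge this returns to the starting
  vertex, so that a semiedge is traversed once by the boundary walk of the face containing it and
  adds one to the size of that face.
\<close>

definition face_next :: "('d, 'm) dart_graph_scheme \<Rightarrow> 'd \<Rightarrow> 'd" where
  "face_next G d = inv_into (darts G) (rot G) (opp G d)"

definition vertices :: "('d, 'm) dart_graph_scheme \<Rightarrow> 'd set set" where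
  "vertices G = orbit (rot G) ` darts G"

definition full_edges :: "('d, 'm) dart_graph_scheme \<Rightarrow> 'd set set" where
  "full_edges G = {{d, opp G d} | d. d \<in> darts G \<and> opp G d \<noteq> d}"

definition faces :: "('d, 'm) dart_graph_scheme \<Rightarrow> 'd set set" where
  "faces G = orbit (face_next G) ` darts G"

definition connected_graph :: "('d, 'm) dart_graph_scheme \<Rightarrow> bool" where
  "connected_graph G \<longleftrightarrow> (\<forall>d\<in>darts G. \<forall>e\<in>darts G.
     (d, e) \<in> ({(x, rot G x) | x. x \<in> darts G} \<union> {(x, opp G x) | x. x \<in> darts G})\<^sup>*)"

text \<open>
  Planarity is Euler's formula. Semiedges are not counted: each of them could be given an
  additional endpoint of its own, which would add one vertex and one edge.
\<close>

definition plane_graph :: "('d, 'm) dart_graph_scheme \<Rightarrow> bool" where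
  "plane_graph G \<longleftrightarrow>
     finite (darts G) \<and> darts G \<noteq> {} \<and>
     bij_betw (rot G) (darts G) (darts G) \<and>
     (\<forall>d\<in>darts G. opp G d \<in> darts G \<and> opp G (opp G d) = d) \<and>
     connected_graph G \<and>
     int (card (vertices G)) - int (card (full_edges G)) + int (card (faces G)) = 2"

definition fullerene_036 :: "('d, 'm) dart_graph_scheme \<Rightarrow> bool" where
  "fullerene_036 G \<longleftrightarrow>
     plane_graph G \<and> (\<forall>v\<in>vertices G. card v = 3) \<and> (\<forall>f\<in>faces G. card f = 3 \<or> card f = 6)"

definition plane_isomorphic :: "('d, 'm) dart_graph_scheme \<Rightarrow> ('e, 'n) dart_graph_scheme \<Rightarrow> bool" where
  "plane_isomorphic G H \<longleftrightarrow> (\<exists>h. bij_betw h (darts G) (darts H) \<and>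
     (\<forall>d\<in>darts G. h (rot G d) = rot H (h d) \<and> h (opp G d) = opp H (h d)))"

text \<open>
  A dart of the dual crosses the dart of the same name, starting from the dual vertex in the face
  on its left.
\<close>

definition dual :: "'d dart_graph \<Rightarrow> 'd dart_graph" where
  "dual G = \<lparr>darts = darts G, rot = face_next G, opp = opp G\<rparr>"


text \<open>The triangular grid, in the complex plane with \<open>a = 1\<close> and \<open>b = cis (pi / 3)\<close>.\<close>

definition gridpoints :: "complex set" where
  "gridpoints = {of_int i * 1 + of_int j * cis (pi / 3) | i j. True}"

definition edgepoints :: "complex set" where
  "edgepoints = {midpoint p q | p q. p \<in> gridpoints \<and> q \<in> gridpoints \<and> dist p q = 1}"

definition angle :: "complex \<Rightarrow> complex \<Rightarrow> complex \<Rightarrow> real" where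
  "angle P Q R = arccos (((P - Q) \<bullet> (R - Q)) / (norm (P - Q) * norm (R - Q)))"

definition nonobtuse_triangle :: "complex \<Rightarrow> complex \<Rightarrow> complex \<Rightarrow> bool" where
  "nonobtuse_triangle A B C \<longleftrightarrow> \<not> collinear {A, B, C} \<and>
     angle B A C \<le> pi / 2 \<and> angle C B A \<le> pi / 2 \<and> angle A C B \<le> pi / 2"

text \<open>A dart of the grid is given by its endpoint and the other endpoint of its edge.\<close>

definition grid_darts :: "(complex \<times> complex) set" where
  "grid_darts = {(p, q). p \<in> gridpoints \<and> q \<in> gridpoints \<and> dist p q = 1}"

definition apex :: "complex \<Rightarrow> complex \<Rightarrow> complex" where
  "apex p q = p + cis (pi / 3) * (q - p)"

fun grid_rot :: "complex \<times> complex \<Rightarrow> complex \<times> complex" where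
  "grid_rot (p, q) = (p, apex p q)"

fun grid_opp :: "complex \<times> complex \<Rightarrow> complex \<times> complex" where
  "grid_opp (p, q) = (q, p)"

text \<open>The open edge of a grid dart, together with the open face of the grid on its left.\<close>

fun flap :: "complex \<times> complex \<Rightarrow> complex set" where
  "flap (p, q) = open_segment p q \<union> interior (convex hull {p, q, apex p q})"

text \<open>
  Folding identifies the two halves of a side \<open>PQ\<close> by the half-turn about its midpoint. Hence
  whatever part of an edge or face of the grid leaves the triangle at a point of \<open>PQ\<close> is
  continued, inside the triangle, by the image of that edge or face under this half-turn (which
  maps the grid to itself, since the midpoint is a gridpoint or an edgepoint). So the pieces cut
  out of the flaps of \<open>d\<close> and of its image belong to one and the same dart of the folded graph
  whenever the flap of \<open>d\<close> meets \<open>PQ\<close>.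
\<close>

definition half_turn :: "complex \<Rightarrow> complex \<Rightarrow> complex" where
  "half_turn M x = 2 * M - x"

definition triangle_sides :: "complex \<Rightarrow> complex \<Rightarrow> complex \<Rightarrow> (complex \<times> complex) set" where
  "triangle_sides A B C = {(B, C), (C, A), (A, B)}"

definition pieces :: "complex \<Rightarrow> complex \<Rightarrow> complex \<Rightarrow> (complex \<times> complex) set" where
  "pieces A B C = {d \<in> grid_darts. flap d \<inter> convex hull {A, B, C} \<noteq> {}}"

definition glue_step :: "complex \<Rightarrow> complex \<Rightarrow> complex \<Rightarrow> ((complex \<times> complex) \<times> (complex \<times> complex)) set" where
  "glue_step A B C =
     {(d, map_prod (half_turn (midpoint P Q)) (half_turn (midpoint P Q)) d) | d P Q.
        d \<in> grid_darts \<and> (P, Q) \<in> triangle_sides A B C \<and> flap d \<inter> closed_segment P Q \<noteq> {}}"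

text \<open>The relation \<open>glue_step\<close> is symmetric, so this is the generated equivalence on pieces.\<close>

definition glued :: "complex \<Rightarrow> complex \<Rightarrow> complex \<Rightarrow> ((complex \<times> complex) \<times> (complex \<times> complex)) set" where
  "glued A B C = {(d, e). d \<in> pieces A B C \<and> e \<in> pieces A B C \<and> (d, e) \<in> (glue_step A B C)\<^sup>*}"

text \<open>
  Rotation and reversal are inherited from the grid. The image of one grid dart in a class may lie
  entirely outside the triangle; such images are discarded by \<open>glued\<close>, and the remaining ones
  form a single class. An edge whose midpoint is a corner of the tetrahedron is glued to its own
  reversal, which makes it a semiedge.
\<close>

definition folded_grid :: "complex \<Rightarrow> complex \<Rightarrow> complex \<Rightarrow> (complex \<times> complex) set dart_graph" where
  "folded_grid A B C =
     \<lparr>darts = pieces A B C // glued A B C,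
      rot = (\<lambda>c. glued A B C `` (grid_rot ` c)),
      opp = (\<lambda>c. glued A B C `` (grid_opp ` c))\<rparr>"

end

theory Submission
  imports Defs "HOL-Combinatorics.Cycles"
begin

text \<open>
  The darts of the triangular grid form a torsor under the group
  \<open>\<langle>r, s | r\<^sup>6, s\<^sup>2, (r s)\<^sup>3\<rangle>\<close>, and face rotation and reversal of a fullerene \<open>F\<close> satisfy the
  same relations. Hence the grid covers the dual of \<open>F\<close>, with a deck group \<open>\<Gamma>\<close> of
  orientation-preserving symmetries of the grid. As all vertices have degree 3 and no face has
  size 1 or 2, \<open>\<Gamma>\<close> contains no rotation of order 3 or 6. Euler's formula forces a triangle or a
  semiedge, that is, a half-turn in \<open>\<Gamma>\<close>, centred at a gridpoint or an edgepoint \<open>c\<close>. So \<open>\<Gamma>\<close>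
  consists of the translations in a lattice \<open>L\<close> of rank 2 and the half-turns about \<open>c + L / 2\<close>. For a
  reduced basis \<open>u, v\<close> of \<open>L\<close> the triangle \<open>c, c + u, c + v\<close> is not obtuse; it is a fundamental
  domain of \<open>\<Gamma>\<close>, and folding it identifies exactly the points that \<open>\<Gamma>\<close> identifies.
\<close>

section \<open>The triangular grid as a universal cover\<close>

text \<open>Covering theory reduces to arithmetic here: the relations make the two lattice
  translations commuting permutations of a finite set, so the covering map can be written down on
  darts with integer coordinates. Finiteness also gives the rank of L, by pigeonhole along 1 and
  \<zeta>. Modulo L the centres c + L / 2 form four classes, represented by c, c + u / 2, c + v / 2
  and c + (u + v) / 2: the corner A and the three side midpoints, that is, the corners of the
  tetrahedron. The triangle is half of a period parallelogram, and the half-turn about the centre of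
  the parallelogram exchanges the two halves. The obstacle is that \<open>glued\<close> is generated
  by steps that must be visible inside the triangle, whereas deck transformations act on whole
  darts, and a flap may cross several copies of the triangle. Points are compared first, by a finite
  case analysis; connectedness of the flap then links all copies that it meets.\<close>

abbreviation \<zeta> :: complex where "\<zeta> \<equiv> cis (pi / 3)"

lemma zeta_eq: "\<zeta> = Complex (1 / 2) (sqrt 3 / 2)"
  by (simp add: complex_eq_iff cos_60 sin_60)

lemma zeta_square: "\<zeta> * \<zeta> = \<zeta> - 1"
  by (simp add: zeta_eq complex_eq_iff)

lemma zeta_powers:
  "\<zeta> ^ 2 = \<zeta> - 1" "\<zeta> ^ 3 = - 1" "\<zeta> ^ 4 = - \<zeta>" "\<zeta> ^ 5 = 1 - \<zeta>" "\<zeta> ^ 6 = 1"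
  by (simp_all add: eval_nat_numeral zeta_square algebra_simps)

lemma zeta_power_mod: "\<zeta> ^ k = \<zeta> ^ (k mod 6)"
proof -
  have "\<zeta> ^ k = \<zeta> ^ (6 * (k div 6) + k mod 6)"
    by simp
  also have "\<dots> = \<zeta> ^ (k mod 6)"
    by (simp only: power_add power_mult zeta_powers) simp
  finally show ?thesis .
qed

definition grid_pt :: "int \<Rightarrow> int \<Rightarrow> complex" where
  "grid_pt i j = of_int i + of_int j * \<zeta>"

lemma gridpoints_eq: "gridpoints = {grid_pt i j | i j. True}"
  by (simp add: gridpoints_def grid_pt_def)

lemma grid_pt_in [simp]: "grid_pt i j \<in> gridpoints"
  by (auto simp: gridpoints_eq)

lemma grid_pt_inj: "grid_pt i j = grid_pt i' j' \<longleftrightarrow> i = i' \<and> j = j'"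
  by (auto simp: grid_pt_def zeta_eq complex_eq_iff)

lemma grid_pt_add: "grid_pt i j + grid_pt k l = grid_pt (i + k) (j + l)"
  by (simp add: grid_pt_def algebra_simps)

lemma grid_pt_minus: "- grid_pt i j = grid_pt (- i) (- j)"
  by (simp add: grid_pt_def)

lemma grid_pt_zeta: "\<zeta> * grid_pt i j = grid_pt (- j) (i + j)"
  by (simp add: grid_pt_def algebra_simps zeta_square)

lemma grid_0 [simp]: "0 \<in> gridpoints" and grid_1 [simp]: "1 \<in> gridpoints"
  and grid_z [simp]: "\<zeta> \<in> gridpoints"
  using grid_pt_in [of 0 0] grid_pt_in [of 1 0] grid_pt_in [of 0 1] by (simp_all add: grid_pt_def)

lemma grid_add [simp]: "x \<in> gridpoints \<Longrightarrow> y \<in> gridpoints \<Longrightarrow> x + y \<in> gridpoints"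
  by (auto simp: gridpoints_eq grid_pt_add) blast

lemma grid_uminus [simp]: "x \<in> gridpoints \<Longrightarrow> - x \<in> gridpoints"
  by (auto simp: gridpoints_eq grid_pt_minus) blast

lemma grid_diff [simp]: "x \<in> gridpoints \<Longrightarrow> y \<in> gridpoints \<Longrightarrow> x - y \<in> gridpoints"
  using grid_add [of x "- y"] by simp

lemma grid_zeta [simp]: "x \<in> gridpoints \<Longrightarrow> \<zeta> * x \<in> gridpoints"
  by (auto simp: gridpoints_eq grid_pt_zeta) blast

lemma grid_zeta_power [simp]: "x \<in> gridpoints \<Longrightarrow> \<zeta> ^ k * x \<in> gridpoints"
  by (induction k) (simp_all add: mult.assoc del: cis_mult)

lemma grid_zeta_power1 [simp]: "\<zeta> ^ k \<in> gridpoints"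
  using grid_zeta_power [OF grid_1] by simp

lemma norm_grid_pt: "(norm (grid_pt i j))\<^sup>2 = of_int (i * i + i * j + j * j)"
  unfolding cmod_power2 by (simp add: grid_pt_def zeta_eq power2_eq_square algebra_simps)

text \<open>Completing the square in either variable confines both coordinates to -1, 0, 1.\<close>

lemma unit_form_solutions:
  fixes i j :: int
  assumes "i * i + i * j + j * j = 1"
  shows "(i, j) \<in> {(1, 0), (0, 1), (-1, 1), (-1, 0), (0, -1), (1, -1)}"
proof -
  have "(2 * i + j)\<^sup>2 + 3 * j\<^sup>2 = 4" "(2 * j + i)\<^sup>2 + 3 * i\<^sup>2 = 4"
    using assms by (simp_all add: power2_eq_square algebra_simps)
  then have "j\<^sup>2 < 4" "i\<^sup>2 < 4"
    using zero_le_power2 [of "2 * i + j"] zero_le_power2 [of "2 * j + i"] by linarith+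
  then have "\<bar>j\<bar> < 2" "\<bar>i\<bar> < 2"
    using power2_less_imp_less [of "\<bar>j\<bar>" 2] power2_less_imp_less [of "\<bar>i\<bar>" 2] by simp_all
  then have "i \<in> {-1, 0, 1}" "j \<in> {-1, 0, 1}"
    by auto
  then show ?thesis
    using assms by auto
qed

lemma unit_gridpoint_zeta_power:
  assumes "x \<in> gridpoints" "norm x = 1"
  obtains k where "k < 6" "x = \<zeta> ^ k"
proof -
  obtain i j where x: "x = grid_pt i j"
    using assms(1) by (auto simp: gridpoints_eq)
  have "i * i + i * j + j * j = 1"
    using norm_grid_pt [of i j] assms(2) unfolding x by (metis of_int_eq_1_iff one_power2)
  from unit_form_solutions [OF this] have "\<exists>k<6. x = \<zeta> ^ k"
    unfolding x grid_pt_def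
    by (elim insertE)
       (auto intro: exI [of _ "0::nat"] exI [of _ "1::nat"] exI [of _ "2::nat"] exI [of _ "3::nat"]
         exI [of _ "4::nat"] exI [of _ "5::nat"] simp: zeta_powers)
  then show thesis
    using that by blast
qed

text \<open>The direction k counts only modulo 6 but is left unreduced, so that rotation is the
  successor function.\<close>

definition grid_dart :: "int \<Rightarrow> int \<Rightarrow> nat \<Rightarrow> complex \<times> complex" where
  "grid_dart i j k = (grid_pt i j, grid_pt i j + \<zeta> ^ k)"

lemma zeta_power_inj:
  assumes "\<zeta> ^ k = \<zeta> ^ l" "k < 6" "l < 6"
  shows "k = l"
proof -
  \<comment> \<open>Coordinates of the powers of \<zeta> from 0 to 5 in the basis 1,
    \<zeta>.\<close>
  let ?a = "[1, 0, -1, -1, 0, 1] :: int list" and ?b = "[0, 1, 1, 0, -1, -1] :: int list"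
  have *: "\<zeta> ^ k = grid_pt (?a ! k) (?b ! k)" if "k < 6" for k
  proof -
    have "k \<in> {0, 1, 2, 3, 4, 5}" using that by auto
    then show ?thesis
      by (auto simp: zeta_powers grid_pt_def)
  qed
  have "?a ! k = ?a ! l \<and> ?b ! k = ?b ! l"
    using assms * grid_pt_inj by metis
  moreover have "k \<in> {0, 1, 2, 3, 4, 5}" "l \<in> {0, 1, 2, 3, 4, 5}" using assms by auto
  ultimately show ?thesis
    by auto
qed

lemma grid_dart_inj:
  "grid_dart i j k = grid_dart i' j' k' \<Longrightarrow> k < 6 \<Longrightarrow> k' < 6 \<Longrightarrow> i = i' \<and> j = j' \<and> k = k'"
  unfolding grid_dart_def using zeta_power_inj by (auto simp: grid_pt_inj)

lemma grid_darts_iff: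
  "d \<in> grid_darts \<longleftrightarrow> (\<exists>p\<in>gridpoints. \<exists>k<6. d = (p, p + \<zeta> ^ k))"
proof
  assume "d \<in> grid_darts"
  then obtain p q where d: "d = (p, q)" "p \<in> gridpoints" "q \<in> gridpoints" "dist p q = 1"
    by (auto simp: grid_darts_def)
  then obtain k where "k < 6" "q - p = \<zeta> ^ k"
    by (metis grid_diff unit_gridpoint_zeta_power dist_norm norm_minus_commute)
  then have "d = (p, p + \<zeta> ^ k)"
    using d by (metis add.commute diff_add_cancel)
  then show "\<exists>p\<in>gridpoints. \<exists>k<6. d = (p, p + \<zeta> ^ k)"
    using d \<open>k < 6\<close> by blast
next
  assume "\<exists>p\<in>gridpoints. \<exists>k<6. d = (p, p + \<zeta> ^ k)"
  then show "d \<in> grid_darts"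
    by (auto simp: grid_darts_def dist_norm norm_power)
qed

lemma grid_darts_cases:
  assumes "d \<in> grid_darts"
  obtains i j k where "k < 6" "d = grid_dart i j k"
  using assms by (auto simp: grid_darts_iff gridpoints_eq grid_dart_def)

lemma grid_dart_in [simp]: "k < 6 \<Longrightarrow> grid_dart i j k \<in> grid_darts"
  by (auto simp: grid_darts_iff grid_dart_def)

lemma grid_dart_mod: "grid_dart i j k = grid_dart i j (k mod 6)"
  unfolding grid_dart_def using zeta_power_mod by metis

lemma grid_rot_dart: "grid_rot (grid_dart i j k) = grid_dart i j (Suc k)"
  by (simp add: grid_dart_def apex_def)

lemma grid_opp_dart:
  "grid_opp (grid_dart i j 0) = grid_dart (i + 1) j 3"
  "grid_opp (grid_dart i j 1) = grid_dart i (j + 1) 4"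
  "grid_opp (grid_dart i j 2) = grid_dart (i - 1) (j + 1) 5"
  "grid_opp (grid_dart i j 3) = grid_dart (i - 1) j 0"
  "grid_opp (grid_dart i j 4) = grid_dart i (j - 1) 1"
  "grid_opp (grid_dart i j 5) = grid_dart (i + 1) (j - 1) 2"
  by (simp_all add: grid_dart_def grid_pt_def zeta_powers algebra_simps)

lemma grid_rot_in [simp]: "d \<in> grid_darts \<Longrightarrow> grid_rot d \<in> grid_darts"
  by (elim grid_darts_cases) (simp add: grid_rot_dart grid_dart_mod [of _ _ "Suc _"])

lemma grid_opp_in [simp]: "d \<in> grid_darts \<Longrightarrow> grid_opp d \<in> grid_darts"
  by (auto simp: grid_darts_def dist_commute)

text \<open>Rotation and reversal act transitively on the grid darts: rotations reach every
  direction at a gridpoint, and a reversal moves on to a neighbour. The function f is arbitrary so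
  that it may be a truth value, as in \<open>deckI\<close>.\<close>

lemma grid_invariant_const:
  assumes "\<And>d. d \<in> grid_darts \<Longrightarrow> f (grid_rot d) = f d"
    and "\<And>d. d \<in> grid_darts \<Longrightarrow> f (grid_opp d) = f d"
    and "d \<in> grid_darts" "e \<in> grid_darts"
  shows "f d = f e"
proof -
  have k: "f (grid_dart i j k) = f (grid_dart i j 0)" for i j k
  proof (induction k)
    case (Suc k)
    have "grid_dart i j k \<in> grid_darts"
      by (subst grid_dart_mod) simp
    from assms(1) [OF this] Suc show ?case
      by (simp add: grid_rot_dart)
  qed simp
  have i: "f (grid_dart (i + 1) j 0) = f (grid_dart i j 0)" for i j
    using assms(2) [of "grid_dart i j 0"] k [of "i + 1" j 3] by (simp add: grid_opp_dart)
  have j: "f (grid_dart i (j + 1) 0) = f (grid_dart i j 0)" for i j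
    using assms(2) [of "grid_dart i j 1"] k [of i "j + 1" 4] k [of i j 1]
    by (simp only: grid_opp_dart) simp
  have i0: "f (grid_dart i j 0) = f (grid_dart 0 j 0)" for i j
  proof (induction i rule: int_induct [where k = 0])
    case (step2 i)
    then show ?case using i [of "i - 1" j] by simp
  qed (simp_all add: i)
  have j0: "f (grid_dart 0 j 0) = f (grid_dart 0 0 0)" for j
  proof (induction j rule: int_induct [where k = 0])
    case (step2 i)
    then show ?case using j [of 0 "i - 1"] by simp
  qed (simp_all add: j)
  show ?thesis
    using assms(3, 4) by (elim grid_darts_cases) (metis k i0 j0)
qed

section \<open>Lattice actions by commuting permutations\<close>

text \<open>Integer iterates of a map of order n; reducing the exponent makes negative ones
  meaningful without an inverse.\<close>

definition fpower :: "('a \<Rightarrow> 'a) \<Rightarrow> nat \<Rightarrow> int \<Rightarrow> 'a \<Rightarrow> 'a" where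
  "fpower f n i = f ^^ nat (i mod int n)"

lemma fpower_Suc:
  assumes "f ^^ n = id" "n > 0"
  shows "fpower f n (i + 1) x = f (fpower f n i x)"
proof (cases "i mod int n + 1 = int n")
  \<comment> \<open>At the wrap-around the left side has exponent 0 and the right side exponent
    n.\<close>
  case True
  have "(i + 1) mod int n = (i mod int n + 1) mod int n"
    by (simp add: mod_simps)
  then have "(i + 1) mod int n = 0"
    using True by simp
  moreover have "Suc (nat (i mod int n)) = n"
    using True by (smt (verit) nat_int Suc_nat_eq_nat_zadd1 assms(2) of_nat_0_less_iff pos_mod_sign)
  then have "f (fpower f n i x) = (f ^^ n) x"
    by (metis fpower_def comp_apply funpow.simps(2))
  ultimately show ?thesis
    using assms by (simp add: fpower_def)
next
  case False
  then have "i mod int n + 1 < int n"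
    using pos_mod_bound [of "int n" i] assms(2) by linarith
  then have "(i + 1) mod int n = i mod int n + 1"
    using mod_pos_pos_trivial [of "i mod int n + 1" "int n"] assms(2) by (simp add: mod_simps)
  then show ?thesis
    using assms(2) by (simp add: fpower_def nat_add_distrib)
qed

lemma funpow_closed: "f ` D \<subseteq> D \<Longrightarrow> x \<in> D \<Longrightarrow> (f ^^ n) x \<in> D"
  by (induction n) auto

text \<open>Finiteness of D gives S and T finite orders, hence integer iterates; commutation lets T
  pass the iterates of S. In the cover, g gives the values on the darts in direction 1.\<close>

lemma commuting_permutations_orbit:
  assumes "finite D" "S permutes D" "T permutes D" and ST: "\<And>x. S (T x) = T (S x)" and "x \<in> D"
  obtains g :: "int \<Rightarrow> int \<Rightarrow> 'd"
  where "\<And>i j. g i j \<in> D" "\<And>i j. g (i + 1) j = S (g i j)" "\<And>i j. g i (j + 1) = T (g i j)"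
proof -
  have "permutation S" "permutation T"
    using assms by (auto simp: permutation_permutes)
  then obtain m n where mn: "S ^^ m = id" "m > 0" "T ^^ n = id" "n > 0"
    by (metis permutation_is_nilpotent)
  define g where "g i j = fpower S m i (fpower T n j x)" for i j
  have ST': "(S ^^ k) (T y) = T ((S ^^ k) y)" for k y
    by (induction k) (simp_all add: ST)
  show thesis
  proof
    show "g i j \<in> D" for i j
      unfolding g_def fpower_def using assms(2,3,5)
      by (intro funpow_closed) (simp_all add: permutes_image)
    show "g (i + 1) j = S (g i j)" for i j
      unfolding g_def using mn by (simp add: fpower_Suc)
    show "g i (j + 1) = T (g i j)" for i j
      unfolding g_def fpower_Suc [OF mn(3,4)] by (simp add: fpower_def ST')
  qed
qed

text \<open>
  Relative to a dart in direction \<open>1\<close>, the translations by \<open>1\<close> and \<open>\<zeta>\<close> are \<open>r\<^sup>3 s\<close> and \<open>r\<^sup>2 s r\<close>;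
  the relations make them commute.
\<close>

lemma grid_covers_total:
  fixes r s :: "'d \<Rightarrow> 'd"
  assumes D: "finite D" "r permutes D" "s permutes D" "x0 \<in> D"
    and r6: "\<And>x. r (r (r (r (r (r x))))) = x" and s2: "\<And>x. s (s x) = x"
    and rs: "\<And>x. r (s (r (s (r (s x))))) = x"
  obtains H where "\<And>d. d \<in> grid_darts \<Longrightarrow> H d \<in> D"
    "\<And>d. d \<in> grid_darts \<Longrightarrow> H (grid_rot d) = r (H d)"
    "\<And>d. d \<in> grid_darts \<Longrightarrow> H (grid_opp d) = s (H d)"
proof -
  define S where "S = r \<circ> r \<circ> r \<circ> s"
  define T where "T = r \<circ> r \<circ> s \<circ> r"
  have perm: "S permutes D" "T permutes D"
    unfolding S_def T_def using D by (auto intro!: permutes_compose)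
  \<comment> \<open>Solves \<open>rs\<close> for r s r: it equals s r^-1 s, and r^-1 is the fifth
    power of r.\<close>
  have rsr: "r (s (r x)) = s (r (r (r (r (r (s x))))))" for x
    by (metis r6 s2 rs)
  have "S (T x) = T (S x)" for x
  proof -
    \<comment> \<open>The word is (r s r)(r s r). Both factors become s r^5 s, the inner s s
      cancels, and r^10 = r^4.\<close>
    have "r (s (r (r (s (r x))))) = s (r (r (r (r (r (s (s (r (r (r (r (r (s x)))))))))))))"
      using rsr [of "r (s (r x))"] rsr [of x] by metis
    then show ?thesis
      by (simp add: S_def T_def s2 r6)
  qed
  from commuting_permutations_orbit [OF D(1) perm this D(4)] obtain g :: "int \<Rightarrow> int \<Rightarrow> 'd"
    where g: "\<And>i j. g i j \<in> D" and gS: "\<And>i j. g (i + 1) j = S (g i j)"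
      and gT: "\<And>i j. g i (j + 1) = T (g i j)"
    by blast
  define ix where "ix d = (SOME x. case x of (i, j, k) \<Rightarrow> k < 6 \<and> d = grid_dart i j k)" for d
  define H where "H d = (case ix d of (i, j, k) \<Rightarrow> (r ^^ k) (g i j))" for d
  have ix: "ix (grid_dart i j k) = (i, j, k)" if "k < 6" for i j k
  proof -
    have "case ix (grid_dart i j k) of (i', j', k') \<Rightarrow> k' < 6 \<and> grid_dart i j k = grid_dart i' j' k'"
      unfolding ix_def by (rule someI [of _ "(i, j, k)"]) (simp add: that)
    then show ?thesis
      using grid_dart_inj that by (cases "ix (grid_dart i j k)") (fastforce split: prod.splits)
  qed
  have H6: "H (grid_dart i j k) = (r ^^ k) (g i j)" if "k < 6" for i j k
    using ix [OF that] by (simp add: H_def)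
  have H: "H (grid_dart i j k) = (r ^^ k) (g i j)" for i j k
  proof -
    have "(r ^^ k) y = (r ^^ (k mod 6)) y" for y
    proof -
      have "(r ^^ 6) = id" using r6 by (auto simp: eval_nat_numeral)
      then show ?thesis using funpow_mod_eq [where f = r and n = 6 and m = k and x = y] by simp
    qed
    then show ?thesis
      using H6 [of "k mod 6" i j] arg_cong [OF grid_dart_mod, of H i j k] by simp
  qed
  show thesis
  proof
    fix d assume "d \<in> grid_darts"
    then obtain i j k where k: "k < 6" and d: "d = grid_dart i j k"
      by (elim grid_darts_cases)
    show "H d \<in> D"
      unfolding d H using D(2) g by (intro funpow_closed) (auto simp: permutes_image)
    show "H (grid_rot d) = r (H d)"
      by (simp add: d H grid_rot_dart)
    \<comment> \<open>In directions 2 to 5 reversal lowers a coordinate; expressing g i j by its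
      predecessor avoids inverses of S and T.\<close>
    have Sm: "g i j = S (g (i - 1) j)" and Tm: "g i j = T (g i (j - 1))" for i j
      using gS [of "i - 1" j] gT [of i "j - 1"] by simp_all
    have "k \<in> {0, 1, 2, 3, 4, 5}" using k by auto
    moreover have "H (grid_opp (grid_dart i j 0)) = s (H (grid_dart i j 0))"
      by (simp only: grid_opp_dart H gS) (simp add: S_def eval_nat_numeral r6)
    moreover have "H (grid_opp (grid_dart i j 1)) = s (H (grid_dart i j 1))"
      by (simp only: grid_opp_dart H gT) (simp add: T_def eval_nat_numeral r6)
    moreover have "H (grid_opp (grid_dart i j 2)) = s (H (grid_dart i j 2))"
      unfolding grid_opp_dart H gT Sm [of i j]
      by (simp add: S_def T_def eval_nat_numeral r6 rsr [symmetric])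
    moreover have "H (grid_opp (grid_dart i j 3)) = s (H (grid_dart i j 3))"
      unfolding grid_opp_dart H Sm [of i j] by (simp add: S_def eval_nat_numeral r6 s2)
    moreover have "H (grid_opp (grid_dart i j 4)) = s (H (grid_dart i j 4))"
      unfolding grid_opp_dart H Tm [of i j] by (simp add: T_def eval_nat_numeral r6 s2)
    moreover have "H (grid_opp (grid_dart i j 5)) = s (H (grid_dart i j 5))"
      unfolding grid_opp_dart H gS Tm [of i j]
      by (simp add: S_def T_def eval_nat_numeral r6 s2) (metis rsr r6 s2)
    ultimately show "H (grid_opp d) = s (H d)"
      unfolding d by blast
  qed
qed

section \<open>Flaps\<close>

definition cross :: "complex \<Rightarrow> complex \<Rightarrow> real" where
  "cross a b = Re a * Im b - Im a * Re b"

lemma not_collinear_if_cross: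
  assumes "cross (b - a) (c - a) \<noteq> 0"
  shows "\<not> collinear {a, b, c}"
proof
  assume "collinear {a, b, c}"
  then consider "a = c" | t where "b = t *\<^sub>R a + (1 - t) *\<^sub>R c"
    by (auto simp: collinear_3_expand)
  then show False
    using assms by cases (auto simp: cross_def algebra_simps)
qed

declare flap.simps [simp del]

lemma cross_zeta: "cross w (\<zeta> * w) = (norm w)\<^sup>2 * (sqrt 3 / 2)"
  unfolding cmod_power2 by (simp add: cross_def zeta_eq power2_eq_square algebra_simps)

text \<open>With origin p and basis q - p, \<zeta> (q - p), the open edge is z = 0 and the open face
  is z > 0, so one system of linear inequalities covers both. Connectedness and invariance under
  moves are read off from it.\<close>

lemma flap_eq:
  assumes "p \<noteq> q"
  shows "flap (p, q) = {p + (of_real y + of_real z * \<zeta>) * (q - p) | y z. 0 < y \<and> 0 \<le> z \<and> y + z < 1}"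
    (is "_ = ?W")
proof -
  let ?a = "apex p q"
  have a: "?a = p + \<zeta> * (q - p)"
    by (simp add: apex_def)
  have "cross (q - p) (?a - p) \<noteq> 0"
    using assms by (simp add: a cross_zeta)
  then have nc: "\<not> collinear {p, q, ?a}"
    by (rule not_collinear_if_cross)
  have comb: "x *\<^sub>R p + y *\<^sub>R q + z *\<^sub>R ?a = p + (of_real y + of_real z * \<zeta>) * (q - p)"
    if "x + y + z = 1" for x y z
  proof -
    have x: "x = 1 - y - z"
      using that by linarith
    show ?thesis
      unfolding x by (simp add: a scaleR_conv_of_real algebra_simps)
  qed
  have seg: "open_segment p q = {(1 - y) *\<^sub>R p + y *\<^sub>R q | y. 0 < y \<and> y < 1}"
    using assms by (auto simp: in_segment)
  show ?thesis
  proof (intro equalityI subsetI)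
    fix v assume "v \<in> flap (p, q)"
    then consider y where "0 < y" "y < 1" "v = (1 - y) *\<^sub>R p + y *\<^sub>R q"
      | x y z where "0 < x" "0 < y" "0 < z" "x + y + z = 1" "x *\<^sub>R p + y *\<^sub>R q + z *\<^sub>R ?a = v"
      by (auto simp: flap.simps seg interior_convex_hull_3_minimal [OF nc])
    then show "v \<in> ?W"
    proof cases
      case 1
      then have "v = p + (of_real y + of_real 0 * \<zeta>) * (q - p)"
        using comb [of "1 - y" y 0] by simp
      then show ?thesis
        using 1 by (intro CollectI exI [of _ y] exI [of _ "0 :: real"]) simp
    next
      case 2
      then have "v = p + (of_real y + of_real z * \<zeta>) * (q - p)"
        using comb [of x y z] by simp
      then show ?thesis
        using 2 by (intro CollectI exI [of _ y] exI [of _ z]) simp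
    qed
  next
    fix v assume "v \<in> ?W"
    then obtain y z where *: "v = p + (of_real y + of_real z * \<zeta>) * (q - p)" "0 < y" "0 \<le> z" "y + z < 1"
      by blast
    then have v: "v = (1 - y - z) *\<^sub>R p + y *\<^sub>R q + z *\<^sub>R ?a"
      using comb [of "1 - y - z" y z] by simp
    show "v \<in> flap (p, q)"
    proof (cases "z = 0")
      case True
      then have "v \<in> open_segment p q"
        using v * seg by auto
      then show ?thesis by (simp add: flap.simps)
    next
      case False
      then have "v \<in> interior (convex hull {p, q, ?a})"
        unfolding interior_convex_hull_3_minimal [OF nc DIM_complex] using v *
        by (intro CollectI exI [of _ "1 - y - z"] exI [of _ y] exI [of _ z]) simp
      then show ?thesis by (simp add: flap.simps)
    qed
  qed
qed

lemma flap_connected: "p \<noteq> q \<Longrightarrow> connected (flap (p, q))"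
proof -
  assume pq: "p \<noteq> q"
  have "flap (p, q) = (\<lambda>(y, z). p + (of_real y + of_real z * \<zeta>) * (q - p)) ` {(y, z). 0 < y \<and> 0 \<le> z \<and> y + z < (1 :: real)}"
    unfolding flap_eq [OF pq] by (auto simp: image_iff)
  moreover have "convex {(y, z). 0 < y \<and> 0 \<le> z \<and> y + z < (1 :: real)}"
  proof -
    have "{(y, z). 0 < y \<and> 0 \<le> z \<and> y + z < (1 :: real)} =
      {x. inner (1, 0) x > (0 :: real)} \<inter> {x. inner (0, 1) x \<ge> (0 :: real)} \<inter> {x. inner (1, 1) x < (1 :: real)}"
      by auto
    then show ?thesis
      by (simp only: convex_Int convex_halfspace_gt convex_halfspace_ge convex_halfspace_lt)
  qed
  then have "connected ((\<lambda>(y, z). p + (of_real y + of_real z * \<zeta>) * (q - p)) ` {(y, z). 0 < y \<and> 0 \<le> z \<and> y + z < (1 :: real)})"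
    by (intro connected_continuous_image convex_connected)
       (auto simp: case_prod_unfold intro!: continuous_intros)
  ultimately show ?thesis
    by simp
qed

lemma flap_bounded: "bounded (flap d)"
proof -
  obtain p q where d: "d = (p, q)" by (cases d)
  have "bounded (convex hull {p, q, apex p q})" "bounded (open_segment p q)"
    by (auto intro!: compact_imp_bounded finite_imp_compact_convex_hull bounded_open_segment)
  then show ?thesis
    unfolding d using bounded_subset interior_subset by (auto simp: flap.simps)
qed

text \<open>The two flaps are disjoint, since the edge from p to the apex belongs to the rotated one
  only. That edge bounds the face of d, however, so its midpoint is a limit of points of
  \<open>flap d\<close>.\<close>

lemma flap_rot_closure:
  assumes "d \<in> grid_darts"
  shows "flap (grid_rot d) \<inter> closure (flap d) \<noteq> {}"
proof -
  obtain p q where d: "d = (p, q)" by (cases d)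
  have pq: "dist p q = 1" "p \<noteq> q"
    using assms by (auto simp: d grid_darts_def)
  define x where "x = p + (1 / 2) * (\<zeta> * (q - p))"
  have "apex p q \<noteq> p"
    using pq by (simp add: apex_def)
  then have "midpoint p (apex p q) \<in> open_segment p (apex p q)"
    by simp
  moreover have "midpoint p (apex p q) = x"
    by (simp add: midpoint_def apex_def x_def scaleR_conv_of_real field_simps)
  ultimately have "x \<in> flap (grid_rot d)"
    by (simp add: d flap.simps)
  moreover have "x \<in> closure (flap d)"
    unfolding closure_approachable
  proof (intro allI impI)
    fix e :: real assume e: "e > 0"
    \<comment> \<open>The bound 1 / 4 keeps y + 1 / 2 below 1, inside the flap.\<close>
    define y where "y = min (e / 2) (1 / 4)"
    let ?v = "p + (of_real y + of_real (1 / 2) * \<zeta>) * (q - p)"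
    have "y > 0" "y + 1 / 2 < 1" "y < e"
      using e by (auto simp: y_def)
    then have "?v \<in> flap d"
      unfolding d flap_eq [OF pq(2)] by (intro CollectI exI [of _ y] exI [of _ "1 / 2 :: real"]) simp
    moreover have "?v - x = of_real y * (q - p)"
      by (simp add: x_def field_simps)
    then have "dist ?v x = y"
      using pq \<open>y > 0\<close> by (simp add: dist_norm norm_mult norm_minus_commute)
    ultimately show "\<exists>v\<in>flap d. dist v x < e"
      using \<open>y < e\<close> by metis
  qed
  ultimately show ?thesis by blast
qed

section \<open>Tiling the plane by a triangle\<close>

lemma grid_of_int_mult [simp]: "x \<in> gridpoints \<Longrightarrow> of_int m * x \<in> gridpoints"
  by (induction m rule: int_induct [where k = 0]) (simp_all add: algebra_simps)

text \<open>
  The map \<open>move s m n\<close> with \<open>s = 1\<close> or \<open>s = - 1\<close> is a translation or a half-turn; these maps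
  form the group generated by the half-turns about the corners of the tetrahedron.
\<close>

locale folding =
  fixes A u v :: complex
  assumes indep: "cross u v \<noteq> 0"
    and grid: "2 * A \<in> gridpoints" "u \<in> gridpoints" "v \<in> gridpoints"
begin

text \<open>Cramer's rule: \<open>sc\<close> and \<open>tc\<close> are the coordinates of x - A in
  the basis u, v.\<close>

definition sc :: "complex \<Rightarrow> real" where "sc x = cross (x - A) v / cross u v"
definition tc :: "complex \<Rightarrow> real" where "tc x = cross u (x - A) / cross u v"

definition move :: "int \<Rightarrow> int \<Rightarrow> int \<Rightarrow> complex \<Rightarrow> complex" where
  "move s m n x = A + of_int s * (x - A) + of_int m * u + of_int n * v"

abbreviation moved :: "int \<Rightarrow> int \<Rightarrow> int \<Rightarrow> complex \<times> complex \<Rightarrow> complex \<times> complex" where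
  "moved s m n \<equiv> map_prod (move s m n) (move s m n)"

abbreviation tri :: "complex set" where "tri \<equiv> convex hull {A, A + u, A + v}"

lemma coords: "x = A + of_real (sc x) * u + of_real (tc x) * v"
proof -
  have "cross u v *\<^sub>R (x - A) = of_real (cross (x - A) v) * u + of_real (cross u (x - A)) * v"
    by (simp add: complex_eq_iff cross_def algebra_simps)
  then have "x - A = (1 / cross u v) *\<^sub>R (of_real (cross (x - A) v) * u + of_real (cross u (x - A)) * v)"
    using indep by (simp flip: \<open>cross u v *\<^sub>R (x - A) = _\<close>)
  also have "\<dots> = of_real (sc x) * u + of_real (tc x) * v"
    using indep
    by (simp add: sc_def tc_def scaleR_conv_of_real add_divide_distrib)
  finally show ?thesis
    by (simp add: algebra_simps)
qed

lemma sc_comb [simp]: "sc (A + of_real a * u + of_real b * v) = a"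
  and tc_comb [simp]: "tc (A + of_real a * u + of_real b * v) = b"
  using indep by (simp_all add: sc_def tc_def cross_def field_simps)

lemma sc_move: "sc (move s m n x) = of_int s * sc x + of_int m"
  and tc_move: "tc (move s m n x) = of_int s * tc x + of_int n"
proof -
  have "move s m n x = A + of_real (of_int s * sc x + of_int m) * u + of_real (of_int s * tc x + of_int n) * v"
    unfolding move_def by (subst coords [of x]) (simp add: algebra_simps)
  then show "sc (move s m n x) = of_int s * sc x + of_int m"
    "tc (move s m n x) = of_int s * tc x + of_int n"
    by (simp_all only: sc_comb tc_comb)
qed

lemma tri_iff: "x \<in> tri \<longleftrightarrow> 0 \<le> sc x \<and> 0 \<le> tc x \<and> sc x + tc x \<le> 1"
proof
  assume "x \<in> tri"
  then obtain a b c where *: "0 \<le> a" "0 \<le> b" "0 \<le> c" "a + b + c = 1"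
      "x = a *\<^sub>R A + b *\<^sub>R (A + u) + c *\<^sub>R (A + v)"
    by (auto simp: convex_hull_3)
  have "x = (a + b + c) *\<^sub>R A + b *\<^sub>R u + c *\<^sub>R v"
    unfolding *(5) by (simp only: scaleR_add_left scaleR_add_right ac_simps)
  then have "x = A + of_real b * u + of_real c * v"
    unfolding *(4) by (simp add: scaleR_conv_of_real)
  then show "0 \<le> sc x \<and> 0 \<le> tc x \<and> sc x + tc x \<le> 1"
    using * by simp
next
  assume *: "0 \<le> sc x \<and> 0 \<le> tc x \<and> sc x + tc x \<le> 1"
  have "x = (1 - sc x - tc x) *\<^sub>R A + sc x *\<^sub>R (A + u) + tc x *\<^sub>R (A + v)"
    by (subst coords [of x]) (simp add: scaleR_conv_of_real algebra_simps)
  then show "x \<in> tri"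
    unfolding convex_hull_3 using * by (intro CollectI exI [of _ "1 - sc x - tc x"] exI [of _ "sc x"] exI [of _ "tc x"]) auto
qed

lemma move_move: "move s m n (move s' m' n' x) = move (s * s') (s * m' + m) (s * n' + n) x"
  by (simp add: move_def algebra_simps)

lemma move_1: "move 1 0 0 = id"
  by (auto simp: move_def)

lemma moved_moved: "moved s m n (moved s' m' n' d) = moved (s * s') (s * m' + m) (s * n' + n) d"
  by (cases d) (simp add: move_move)

lemma move_grid: "\<bar>s\<bar> = 1 \<Longrightarrow> p \<in> gridpoints \<Longrightarrow> move s m n p \<in> gridpoints"
proof -
  assume s: "\<bar>s\<bar> = 1" and p: "p \<in> gridpoints"
  \<comment> \<open>A half-turn involves A only through 2 A, which is a gridpoint even when A is an
    edgepoint.\<close>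
  have "move s m n p = (if s = 1 then p else 2 * A - p) + of_int m * u + of_int n * v"
    using s by (auto simp: move_def abs_if split: if_splits)
  then show ?thesis
    using grid p by simp
qed

lemma moved_in: "\<bar>s\<bar> = 1 \<Longrightarrow> d \<in> grid_darts \<Longrightarrow> moved s m n d \<in> grid_darts"
proof -
  assume s: "\<bar>s\<bar> = 1" and d: "d \<in> grid_darts"
  have "dist (move s m n p) (move s m n q) = dist p q" for p q
  proof -
    have "move s m n p - move s m n q = of_int s * (p - q)"
      by (simp add: move_def algebra_simps)
    then show ?thesis
      using s by (metis dist_norm mult_1 norm_mult norm_of_int of_int_1 of_int_abs)
  qed
  then show ?thesis
    using d s by (auto simp: grid_darts_def move_grid)
qed

text \<open>Moves are complex affine, so the coordinates y, z of \<open>flap_eq\<close> do not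
  change.\<close>

lemma flap_move:
  assumes "\<bar>s\<bar> = 1" "d \<in> grid_darts" "x \<in> flap d"
  shows "move s m n x \<in> flap (moved s m n d)"
proof -
  obtain p q where d: "d = (p, q)" by (cases d)
  have pq: "p \<noteq> q" and pq': "move s m n p \<noteq> move s m n q"
    using assms(1,2) moved_in [OF assms(1,2), of m n] by (auto simp: d grid_darts_def)
  obtain y z where *: "0 < y" "0 \<le> z" "y + z < 1" "x = p + (of_real y + of_real z * \<zeta>) * (q - p)"
    using assms(3) unfolding d flap_eq [OF pq] by blast
  have "move s m n x = move s m n p + (of_real y + of_real z * \<zeta>) * (move s m n q - move s m n p)"
    by (simp add: *(4) move_def algebra_simps)
  then show ?thesis
    unfolding d map_prod_simp flap_eq [OF pq'] using * by blast
qed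

section \<open>Gluing along the sides of the triangle\<close>

lemma half_turn_midpoint:
  assumes "P + Q = 2 * A + of_int m * u + of_int n * v"
  shows "half_turn (midpoint P Q) = move (- 1) m n"
proof
  fix y
  have "2 * midpoint P Q = P + Q"
    by (simp add: midpoint_def scaleR_conv_of_real)
  then show "half_turn (midpoint P Q) y = move (- 1) m n y"
    using assms by (simp add: half_turn_def move_def)
qed

text \<open>With B = A + u and C = A + v, the sides AB, CA, BC are where tc, sc, sc + tc - 1 vanish.
  The endpoint sums 2 A + u, 2 A + v, 2 A + u + v yield the parameters (1, 0), (0, 1), (1,
  1).\<close>

lemma glue_steps:
  assumes "d \<in> grid_darts" "x \<in> flap d" "x \<in> tri"
  shows "tc x = 0 \<Longrightarrow> (d, moved (- 1) 1 0 d) \<in> glue_step A (A + u) (A + v)"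
    and "sc x = 0 \<Longrightarrow> (d, moved (- 1) 0 1 d) \<in> glue_step A (A + u) (A + v)"
    and "sc x + tc x = 1 \<Longrightarrow> (d, moved (- 1) 1 1 d) \<in> glue_step A (A + u) (A + v)"
proof -
  have *: "(d, moved (- 1) m n d) \<in> glue_step A (A + u) (A + v)"
    if "(P, Q) \<in> triangle_sides A (A + u) (A + v)" "0 \<le> a" "a \<le> 1"
      "x = (1 - a) *\<^sub>R P + a *\<^sub>R Q" "P + Q = 2 * A + of_int m * u + of_int n * v" for P Q a m n
  proof -
    have "half_turn (midpoint P Q) = move (- 1) m n"
      using that(5) by (rule half_turn_midpoint)
    moreover have "x \<in> closed_segment P Q"
      using that by (auto simp: in_segment)
    ultimately show ?thesis
      unfolding glue_step_def using that(1) assms by (intro CollectI exI [of _ d] exI [of _ P] exI [of _ Q]) auto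
  qed
  note x = coords [of x] and t = assms(3) [unfolded tri_iff]
  {
    assume "tc x = 0"
    then have "x = (1 - sc x) *\<^sub>R A + sc x *\<^sub>R (A + u)"
      using x by (simp add: scaleR_conv_of_real algebra_simps)
    with * [of A "A + u" "sc x" 1 0] t
    show "(d, moved (- 1) 1 0 d) \<in> glue_step A (A + u) (A + v)"
      by (simp add: triangle_sides_def)
  next
    assume "sc x = 0"
    then have "x = (1 - (1 - tc x)) *\<^sub>R (A + v) + (1 - tc x) *\<^sub>R A"
      using x by (simp add: scaleR_conv_of_real algebra_simps)
    with * [of "A + v" A "1 - tc x" 0 1] t
    show "(d, moved (- 1) 0 1 d) \<in> glue_step A (A + u) (A + v)"
      by (simp add: triangle_sides_def)
  next
    assume "sc x + tc x = 1"
    then have sc: "sc x = 1 - tc x" by simp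
    have "x = (1 - tc x) *\<^sub>R (A + u) + tc x *\<^sub>R (A + v)"
      using x unfolding sc by (simp add: scaleR_conv_of_real algebra_simps)
    with * [of "A + u" "A + v" "tc x" 1 1] t sc
    show "(d, moved (- 1) 1 1 d) \<in> glue_step A (A + u) (A + v)"
      by (simp add: triangle_sides_def)
  }
qed

lemma glue_step_moved:
  assumes "(d, e) \<in> glue_step A (A + u) (A + v)"
  shows "\<exists>m n. e = moved (- 1) m n d"
proof -
  obtain P Q where PQ: "(P, Q) \<in> triangle_sides A (A + u) (A + v)"
      and e: "e = map_prod (half_turn (midpoint P Q)) (half_turn (midpoint P Q)) d"
    using assms unfolding glue_step_def by blast
  have "\<exists>m n. P + Q = 2 * A + of_int m * u + of_int n * v"
    using PQ unfolding triangle_sides_def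
    by (auto intro: exI [of _ 1] exI [of _ 0])
  then obtain m n where mn: "P + Q = 2 * A + of_int m * u + of_int n * v"
    by blast
  then show ?thesis
    using e half_turn_midpoint [OF mn] by auto
qed

abbreviation "glue \<equiv> glue_step A (A + u) (A + v)"

text \<open>Prolongs a chain of gluings across one side: the half-turn with parameters a, b after
  \<open>move s m n\<close> has parameters - s, a - m, b - n. The conditions refer to the
  coordinates of the fixed point x, so chains can be followed by arithmetic.\<close>

lemma glue_next:
  assumes "d \<in> grid_darts" "(d, moved s m n d) \<in> glue\<^sup>*" "x \<in> flap d" "\<bar>s\<bar> = 1"
    "0 \<le> of_int s * sc x + of_int m" "0 \<le> of_int s * tc x + of_int n"
    "of_int s * sc x + of_int m + (of_int s * tc x + of_int n) \<le> 1"
  shows "of_int s * tc x + of_int n = 0 \<Longrightarrow> (d, moved (- s) (1 - m) (- n) d) \<in> glue\<^sup>*"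
    and "of_int s * sc x + of_int m = 0 \<Longrightarrow> (d, moved (- s) (- m) (1 - n) d) \<in> glue\<^sup>*"
    and "of_int s * sc x + of_int m + (of_int s * tc x + of_int n) = 1 \<Longrightarrow>
      (d, moved (- s) (1 - m) (1 - n) d) \<in> glue\<^sup>*"
proof -
  have t: "move s m n x \<in> tri"
    using assms by (simp add: tri_iff sc_move tc_move)
  note gl = glue_steps [OF moved_in [OF assms(4,1)] flap_move [OF assms(4,1,3)] t,
      unfolded moved_moved sc_move tc_move]
  show "of_int s * tc x + of_int n = 0 \<Longrightarrow> (d, moved (- s) (1 - m) (- n) d) \<in> glue\<^sup>*"
    using rtrancl.rtrancl_into_rtrancl [OF assms(2) gl(1)] by simp
  show "of_int s * sc x + of_int m = 0 \<Longrightarrow> (d, moved (- s) (- m) (1 - n) d) \<in> glue\<^sup>*"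
    using rtrancl.rtrancl_into_rtrancl [OF assms(2) gl(2)] by simp
  show "of_int s * sc x + of_int m + (of_int s * tc x + of_int n) = 1 \<Longrightarrow>
      (d, moved (- s) (1 - m) (1 - n) d) \<in> glue\<^sup>*"
    using rtrancl.rtrancl_into_rtrancl [OF assms(2) gl(3)] by simp
qed

lemma moved_1: "moved 1 0 0 d = d"
  by (simp add: move_1 map_prod.id)

text \<open>
  Away from the corners of the triangle at most one half-turn keeps a point in it; at a corner the
  three half-turns are applied cyclically, which runs through the six triangles around the corner.
\<close>

lemma glue_at_point:
  assumes d: "d \<in> grid_darts" and x: "x \<in> flap d" and t: "x \<in> tri" "move s m n x \<in> tri"
    and s: "\<bar>s\<bar> = 1"
  shows "(d, moved s m n d) \<in> glue\<^sup>*"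
proof -
  have id: "(d, moved 1 0 0 d) \<in> glue\<^sup>*"
    unfolding moved_1 by simp
  note nx = glue_next [OF d _ x]
  have t0: "0 \<le> sc x" "0 \<le> tc x" "sc x + tc x \<le> 1"
    using t(1) by (auto simp: tri_iff)
  have t1: "0 \<le> of_int s * sc x + of_int m" "0 \<le> of_int s * tc x + of_int n"
      "of_int s * sc x + of_int m + (of_int s * tc x + of_int n) \<le> 1"
    using t(2) by (auto simp: tri_iff sc_move tc_move)
  have s': "s = 1 \<or> s = - 1"
    using s by linarith
  consider (A) "sc x = 0" "tc x = 0" | (B) "sc x = 1" "tc x = 0" | (C) "sc x = 0" "tc x = 1"
    | (no) "\<not> (sc x = 0 \<and> tc x = 0)" "\<not> (sc x = 1 \<and> tc x = 0)" "\<not> (sc x = 0 \<and> tc x = 1)"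
    by blast
  then show ?thesis
  proof cases
    case A
    have 1: "(d, moved (- 1) 1 0 d) \<in> glue\<^sup>*" using nx(1) [OF id] by (simp add: A)
    have 2: "(d, moved 1 0 1 d) \<in> glue\<^sup>*" using nx(3) [OF 1] by (simp add: A)
    have 3: "(d, moved (- 1) 0 0 d) \<in> glue\<^sup>*" using nx(2) [OF 2] by (simp add: A)
    have 4: "(d, moved 1 1 0 d) \<in> glue\<^sup>*" using nx(1) [OF 3] by (simp add: A)
    have 5: "(d, moved (- 1) 0 1 d) \<in> glue\<^sup>*" using nx(3) [OF 4] by (simp add: A)
    have "0 \<le> m" "0 \<le> n" "m + n \<le> 1"
      using t1 A by simp_all
    then have "m = 0 \<and> n = 0 \<or> m = 1 \<and> n = 0 \<or> m = 0 \<and> n = 1"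
      by linarith
    then show ?thesis
      using s' id 1 2 3 4 5 by (elim disjE conjE) simp_all
  next
    case B
    have 1: "(d, moved (- 1) 1 1 d) \<in> glue\<^sup>*" using nx(3) [OF id] by (simp add: B)
    have 2: "(d, moved 1 (- 1) 0 d) \<in> glue\<^sup>*" using nx(2) [OF 1] by (simp add: B)
    have 3: "(d, moved (- 1) 2 0 d) \<in> glue\<^sup>*" using nx(1) [OF 2] by (simp add: B)
    have 4: "(d, moved 1 (- 1) 1 d) \<in> glue\<^sup>*" using nx(3) [OF 3] by (simp add: B)
    have 5: "(d, moved (- 1) 1 0 d) \<in> glue\<^sup>*" using nx(2) [OF 4] by (simp add: B)
    have "real_of_int 0 \<le> of_int (s + m)" "real_of_int 0 \<le> of_int n" "real_of_int (s + m + n) \<le> of_int 1"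
      using t1 B by simp_all
    then have "0 \<le> s + m" "0 \<le> n" "s + m + n \<le> 1"
      by (simp_all only: of_int_le_iff)
    then have "s + m = 0 \<and> n = 0 \<or> s + m = 1 \<and> n = 0 \<or> s + m = 0 \<and> n = 1"
      by linarith
    then have "s = 1 \<and> (m = - 1 \<and> n = 0 \<or> m = 0 \<and> n = 0 \<or> m = - 1 \<and> n = 1) \<or>
        s = - 1 \<and> (m = 1 \<and> n = 0 \<or> m = 2 \<and> n = 0 \<or> m = 1 \<and> n = 1)"
      using s' by auto
    then show ?thesis
      using id 1 2 3 4 5 by (elim disjE conjE) simp_all
  next
    case C
    have 1: "(d, moved (- 1) 0 1 d) \<in> glue\<^sup>*" using nx(2) [OF id] by (simp add: C)
    have 2: "(d, moved 1 1 (- 1) d) \<in> glue\<^sup>*" using nx(1) [OF 1] by (simp add: C)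
    have 3: "(d, moved (- 1) 0 2 d) \<in> glue\<^sup>*" using nx(3) [OF 2] by (simp add: C)
    have 4: "(d, moved 1 0 (- 1) d) \<in> glue\<^sup>*" using nx(2) [OF 3] by (simp add: C)
    have 5: "(d, moved (- 1) 1 1 d) \<in> glue\<^sup>*" using nx(1) [OF 4] by (simp add: C)
    have "real_of_int 0 \<le> of_int m" "real_of_int 0 \<le> of_int (s + n)" "real_of_int (m + (s + n)) \<le> of_int 1"
      using t1 C by simp_all
    then have "0 \<le> m" "0 \<le> s + n" "m + (s + n) \<le> 1"
      by (simp_all only: of_int_le_iff)
    then have "m = 0 \<and> s + n = 0 \<or> m = 1 \<and> s + n = 0 \<or> m = 0 \<and> s + n = 1"
      by linarith
    then have "s = 1 \<and> (m = 0 \<and> n = - 1 \<or> m = 0 \<and> n = 0 \<or> m = 1 \<and> n = - 1) \<or>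
        s = - 1 \<and> (m = 0 \<and> n = 1 \<or> m = 0 \<and> n = 2 \<or> m = 1 \<and> n = 1)"
      using s' by auto
    then show ?thesis
      using id 1 2 3 4 5 by (elim disjE conjE) simp_all
  next
    case no
    show ?thesis
    proof (cases "s = 1")
      \<comment> \<open>A nonzero lattice translation can keep only corners inside the triangle, and
        \<open>no\<close> excludes corners.\<close>
      case True
      then have t1': "0 \<le> sc x + of_int m" "0 \<le> tc x + of_int n"
          "sc x + of_int m + (tc x + of_int n) \<le> 1"
        using t1 by simp_all
      have "m < 1"
      proof (rule ccontr)
        assume "\<not> m < 1"
        then have "1 \<le> real_of_int m" by simp
        then have "sc x = 0" and n: "tc x = - of_int n"
          using t0 t1' by linarith+
        then have "real_of_int n \<le> of_int 0" "of_int (- 1) \<le> real_of_int n"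
          using t0 by simp_all
        then have "n \<le> 0" "- 1 \<le> n"
          by (simp_all only: of_int_le_iff)
        then have "n = 0 \<or> n = - 1"
          by linarith
        then show False
          using no n \<open>sc x = 0\<close> by auto
      qed
      moreover have "\<not> m \<le> - 1"
      proof
        assume "m \<le> - 1"
        then have "real_of_int m \<le> - 1" by simp
        then have "sc x = 1 \<and> tc x = 0"
          using t0 t1' by linarith
        then show False
          using no by simp
      qed
      ultimately have m: "m = 0" by simp
      have "n < 1"
      proof (rule ccontr)
        assume "\<not> n < 1"
        then have "1 \<le> real_of_int n" by simp
        then have "sc x = 0 \<and> tc x = 0"
          using t0 t1' m by simp
        then show False
          using no by simp
      qed
      moreover have "\<not> n \<le> - 1"
      proof
        assume "n \<le> - 1"
        then have "real_of_int n \<le> - 1" by simp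
        then have "sc x = 0 \<and> tc x = 1"
          using t0 t1' by linarith
        then show False
          using no by simp
      qed
      ultimately have n: "n = 0" by simp
      show ?thesis
        using id True m n by simp
    next
      case False
      with s' have s: "s = - 1" by simp
      have mn: "sc x \<le> of_int m" "tc x \<le> of_int n" "of_int m + of_int n \<le> 1 + (sc x + tc x)"
        using t1 s by simp_all
      have "real_of_int (m + n) \<le> of_int 2" "real_of_int 0 \<le> of_int m" "real_of_int 0 \<le> of_int n"
        using mn t0 by simp_all
      then have "m + n \<le> 2" "0 \<le> m" "0 \<le> n"
        by (simp_all only: of_int_le_iff)
      \<comment> \<open>The pairs (0, 0), (2, 0), (0, 2) are half-turns about A, B, C, which keep
        only that corner in the triangle; the other three belong to the sides and keep only points
        of that side.\<close>
      then consider "m = 0" "n = 0" | "m = 1" "n = 0" | "m = 0" "n = 1" | "m = 1" "n = 1"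
        | "m = 2" "n = 0" | "m = 0" "n = 2"
        by linarith
      then show ?thesis
      proof cases
        case 1
        then show ?thesis using mn t0 no by simp
      next
        case 2
        then show ?thesis using nx(1) [OF id] mn t0 s by simp
      next
        case 3
        then show ?thesis using nx(2) [OF id] mn t0 s by simp
      next
        case 4
        then show ?thesis using nx(3) [OF id] mn t0 s by simp
      next
        case 5
        then show ?thesis using mn t0 no by simp
      next
        case 6
        then show ?thesis using mn t0 no by simp
      qed
    qed
  qed
qed

section \<open>Tiling of the plane by the moved triangles\<close>

text \<open>Dropping integer parts brings x into the period parallelogram at A; beyond the diagonal,
  the half-turn about its centre carries x into the triangle.\<close>

lemma tiles_cover: obtains s m n where "\<bar>s\<bar> = 1" "move s m n x \<in> tri"
proof (cases "frac (sc x) + frac (tc x) \<le> 1")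
  case True
  then have "move 1 (- \<lfloor>sc x\<rfloor>) (- \<lfloor>tc x\<rfloor>) x \<in> tri"
    using frac_ge_0 [of "sc x"] frac_ge_0 [of "tc x"]
    by (simp add: tri_iff sc_move tc_move frac_def)
  then show thesis
    by (intro that [of 1]) simp_all
next
  case False
  then have "move (- 1) (\<lfloor>sc x\<rfloor> + 1) (\<lfloor>tc x\<rfloor> + 1) x \<in> tri"
    using frac_lt_1 [of "sc x"] frac_lt_1 [of "tc x"]
    by (simp add: tri_iff sc_move tc_move frac_def)
  then show thesis
    by (intro that [of "- 1"]) simp_all
qed

text \<open>Local finiteness of the tiling, needed because only finite unions of closed tiles are
  known to be closed.\<close>

lemma tiles_finite:
  assumes "bounded S"
  obtains J where "finite J" "\<And>x s m n. x \<in> S \<Longrightarrow> \<bar>s\<bar> = 1 \<Longrightarrow> move s m n x \<in> tri \<Longrightarrow> (s, m, n) \<in> J"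
proof -
  have "bounded (f ` S)" if "continuous_on UNIV f" for f :: "complex \<Rightarrow> real"
  proof -
    have "compact (f ` closure S)"
      using assms that by (intro compact_continuous_image) (auto intro: continuous_on_subset)
    then show ?thesis
      by (meson bounded_subset closure_subset compact_imp_bounded image_mono)
  qed
  moreover have "continuous_on UNIV sc" "continuous_on UNIV tc"
    using indep unfolding sc_def [abs_def] tc_def [abs_def]
    by (auto simp: cross_def intro!: continuous_intros)
  ultimately have "bounded (sc ` S)" "bounded (tc ` S)"
    by blast+
  then obtain a b where ab: "\<And>x. x \<in> S \<Longrightarrow> \<bar>sc x\<bar> \<le> a" "\<And>x. x \<in> S \<Longrightarrow> \<bar>tc x\<bar> \<le> b"
    by (auto simp: bounded_iff)
  \<comment> \<open>The added 1 allows for coordinates up to 1 inside the triangle.\<close>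
  define N where "N = \<lceil>max a b\<rceil> + 1"
  have N: "a + 1 \<le> of_int N" "b + 1 \<le> of_int N"
    by (auto simp: N_def) (linarith)+
  show thesis
  proof
    show "finite ({- 1, 1} \<times> {- N..N} \<times> {- N..N})"
      by simp
    fix x s m n assume x: "x \<in> S" "\<bar>s\<bar> = (1 :: int)" "move s m n x \<in> tri"
    have s: "s = 1 \<or> s = - 1"
      using x(2) by linarith
    have "real_of_int m \<le> of_int N \<and> of_int (- N) \<le> real_of_int m \<and>
        real_of_int n \<le> of_int N \<and> of_int (- N) \<le> real_of_int n"
      using x(3) ab [OF x(1)] N s by (auto simp: tri_iff sc_move tc_move)
    then show "(s, m, n) \<in> {- 1, 1} \<times> {- N..N} \<times> {- N..N}"
      using s by (simp only: of_int_le_iff) auto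
  qed
qed

lemma closed_tile: "closed {x. move s m n x \<in> tri}"
proof -
  have "closed (move s m n -` tri)"
    unfolding move_def
    by (intro continuous_closed_vimage compact_imp_closed finite_imp_compact_convex_hull) auto
  then show ?thesis
    by (simp add: vimage_def)
qed

lemma move_inverse:
  assumes "\<bar>s\<bar> = 1"
  shows "move s (- s * m) (- s * n) (move s m n x) = x" "move s m n (move s (- s * m) (- s * n) x) = x"
proof -
  have "s * s = 1"
    using assms by (metis abs_mult_self_eq mult_1)
  then show "move s (- s * m) (- s * n) (move s m n x) = x" "move s m n (move s (- s * m) (- s * n) x) = x"
    using move_1 by (simp_all add: move_move mult.assoc [symmetric])
qed

lemma flap_move_iff:
  assumes "\<bar>s\<bar> = 1" "d \<in> grid_darts"
  shows "move s m n x \<in> flap (moved s m n d) \<longleftrightarrow> x \<in> flap d"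
proof
  assume "move s m n x \<in> flap (moved s m n d)"
  from flap_move [OF assms(1) moved_in [OF assms] this, of "- s * m" "- s * n"]
  show "x \<in> flap d"
    by (cases d) (simp only: map_prod_simp move_inverse [OF assms(1)])
qed (use assms in \<open>rule flap_move\<close>)

text \<open>Sort the finitely many closed tiles that meet the flap by whether gluing reaches the
  corresponding image of d. If both sorts occurred, connectedness would provide a point of the flap
  in a tile of each sort, and \<open>glue_at_point\<close> would link the two images.\<close>

lemma glue_connected:
  assumes d: "d \<in> grid_darts" "flap d \<inter> tri \<noteq> {}" and e: "flap (moved s m n d) \<inter> tri \<noteq> {}"
    and s: "\<bar>s\<bar> = 1"
  shows "(d, moved s m n d) \<in> glue\<^sup>*"
proof (rule ccontr)
  assume not: "(d, moved s m n d) \<notin> glue\<^sup>*"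
  obtain J where J: "finite J"
      "\<And>x s m n. x \<in> flap d \<Longrightarrow> \<bar>s\<bar> = 1 \<Longrightarrow> move s m n x \<in> tri \<Longrightarrow> (s, m, n) \<in> J"
    using tiles_finite [OF flap_bounded [of d]] by metis
  define K where "K = (\<lambda>(s, m, n). {x. move s m n x \<in> tri})"
  define R where "R = {(s, m, n). \<bar>s\<bar> = 1 \<and> (d, moved s m n d) \<in> glue\<^sup>*}"
  define R' where "R' = {(s, m, n). \<bar>s\<bar> = 1 \<and> (d, moved s m n d) \<notin> glue\<^sup>*}"
  let ?E1 = "\<Union>j\<in>J \<inter> R. K j" and ?E2 = "\<Union>j\<in>J \<inter> R'. K j"
  have "closed ?E1" "closed ?E2"
    using J(1) by (auto simp: K_def closed_tile intro!: closed_UN)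
  moreover have "flap d \<subseteq> ?E1 \<union> ?E2"
  proof
    fix x assume x: "x \<in> flap d"
    obtain s m n where *: "\<bar>s\<bar> = 1" "move s m n x \<in> tri"
      by (rule tiles_cover)
    then have "(s, m, n) \<in> J"
      using J(2) x by blast
    then show "x \<in> ?E1 \<union> ?E2"
      using * by (cases "(s, m, n) \<in> R") (fastforce simp: K_def R_def R'_def)+
  qed
  moreover have "?E1 \<inter> flap d \<noteq> {}"
  proof -
    obtain x where x: "x \<in> flap d" "x \<in> tri"
      using d by blast
    then have "(1, 0, 0) \<in> J \<inter> R"
      using J(2) [of x 1 0 0] moved_1 by (simp add: R_def move_1)
    moreover have "x \<in> K (1, 0, 0)"
      using x by (simp add: K_def move_1)
    ultimately show ?thesis
      using x by blast
  qed
  moreover have "?E2 \<inter> flap d \<noteq> {}"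
  proof -
    obtain y where y: "y \<in> flap (moved s m n d)" "y \<in> tri"
      using e by blast
    define x where "x = move s (- s * m) (- s * n) y"
    have xy: "move s m n x = y"
      unfolding x_def by (rule move_inverse [OF s])
    then have x: "x \<in> flap d"
      using flap_move_iff [OF s d(1)] y(1) by metis
    then have "(s, m, n) \<in> J \<inter> R'" "x \<in> K (s, m, n)"
      using J(2) [of x s m n] xy y(2) s not by (auto simp: R'_def K_def)
    then show ?thesis
      using x by blast
  qed
  moreover have "connected (flap d)"
    using d(1) by (cases d) (auto simp: grid_darts_def intro: flap_connected)
  ultimately have "?E1 \<inter> ?E2 \<inter> flap d \<noteq> {}"
    using connected_closedD [of "flap d" ?E1 ?E2] by metis
  then obtain x s1 m1 n1 s2 m2 n2 where x: "x \<in> flap d"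
      and 1: "\<bar>s1\<bar> = 1" "(d, moved s1 m1 n1 d) \<in> glue\<^sup>*" "move s1 m1 n1 x \<in> tri"
      and 2: "\<bar>s2\<bar> = 1" "(d, moved s2 m2 n2 d) \<notin> glue\<^sup>*" "move s2 m2 n2 x \<in> tri"
    by (auto simp: R_def R'_def K_def)
  \<comment> \<open>The second move after the inverse of the first; it carries one image of x to the
    other, both in the triangle.\<close>
  obtain s3 m3 n3 where 3: "\<bar>s3\<bar> = 1" "s3 * s1 = s2" "s3 * m1 + m3 = m2" "s3 * n1 + n3 = n2"
  proof
    have "s1 * s1 = 1"
      using 1(1) by (metis abs_mult_self_eq mult_1)
    then show "s2 * s1 * s1 = s2" by (simp add: mult.assoc)
    show "\<bar>s2 * s1\<bar> = 1"
      using 1(1) 2(1) by (simp add: abs_mult)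
    show "s2 * s1 * m1 + (m2 - s2 * s1 * m1) = m2" "s2 * s1 * n1 + (n2 - s2 * s1 * n1) = n2"
      by simp_all
  qed
  have "(moved s1 m1 n1 d, moved s3 m3 n3 (moved s1 m1 n1 d)) \<in> glue\<^sup>*"
    using 1 2 3 d x by (intro glue_at_point [of _ "move s1 m1 n1 x"])
      (auto simp: move_move moved_in flap_move)
  then have "(moved s1 m1 n1 d, moved s2 m2 n2 d) \<in> glue\<^sup>*"
    using 3 by (simp add: moved_moved)
  then show False
    using 1(2) 2(2) rtrancl_trans by metis
qed

lemma moved_rot: "moved s m n (grid_rot d) = grid_rot (moved s m n d)"
  by (cases d) (simp add: apex_def move_def algebra_simps)

lemma moved_opp: "moved s m n (grid_opp d) = grid_opp (moved s m n d)"
  by (cases d) simp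

section \<open>The folded grid as a quotient of the grid\<close>

abbreviation "tri_pieces \<equiv> pieces A (A + u) (A + v)"

text \<open>Finitely many closed tiles that meet \<open>flap d\<close> cover it, hence also its
  closure, which contains a point of the rotated flap. So one tile meets both flaps.\<close>

lemma rot_pieces:
  assumes d: "d \<in> grid_darts"
  obtains s m n where "\<bar>s\<bar> = 1" "moved s m n d \<in> tri_pieces" "moved s m n (grid_rot d) \<in> tri_pieces"
proof -
  obtain J where J: "finite J"
      "\<And>x s m n. x \<in> flap d \<Longrightarrow> \<bar>s\<bar> = 1 \<Longrightarrow> move s m n x \<in> tri \<Longrightarrow> (s, m, n) \<in> J"
    using tiles_finite [OF flap_bounded [of d]] by metis
  define K where "K = (\<lambda>(s, m, n). {x. move s m n x \<in> tri})"
  define R where "R = {(s, m, n). \<bar>s\<bar> = 1 \<and> K (s, m, n) \<inter> flap d \<noteq> {}}"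
  have "closed (\<Union>j\<in>J \<inter> R. K j)"
    using J(1) by (auto simp: K_def closed_tile intro!: closed_UN)
  moreover have "flap d \<subseteq> (\<Union>j\<in>J \<inter> R. K j)"
  proof
    fix x assume x: "x \<in> flap d"
    obtain s m n where *: "\<bar>s\<bar> = 1" "move s m n x \<in> tri"
      by (rule tiles_cover)
    then have "(s, m, n) \<in> J \<inter> R" "x \<in> K (s, m, n)"
      using J(2) x by (auto simp: K_def R_def)
    then show "x \<in> (\<Union>j\<in>J \<inter> R. K j)"
      by blast
  qed
  ultimately have "closure (flap d) \<subseteq> (\<Union>j\<in>J \<inter> R. K j)"
    by (rule closure_minimal [rotated])
  then obtain x y s m n where *: "x \<in> flap (grid_rot d)" "\<bar>s\<bar> = 1" "y \<in> flap d"
      "move s m n x \<in> tri" "move s m n y \<in> tri"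
    using flap_rot_closure [OF d] by (fastforce simp: K_def R_def)
  show thesis
  proof
    show "\<bar>s\<bar> = 1" by fact
    show "moved s m n d \<in> tri_pieces"
      using * d flap_move [of s d y m n] by (auto simp: pieces_def moved_in)
    show "moved s m n (grid_rot d) \<in> tri_pieces"
      using * d flap_move [of s "grid_rot d" x m n]
        moved_in [of s "grid_rot d" m n] unfolding pieces_def by auto
  qed
qed

text \<open>A dart and its reversal share their open edge, so any tile through its midpoint meets
  both flaps.\<close>

lemma opp_pieces:
  assumes d: "d \<in> grid_darts"
  obtains s m n where "\<bar>s\<bar> = 1" "moved s m n d \<in> tri_pieces" "moved s m n (grid_opp d) \<in> tri_pieces"
proof -
  obtain p q where pq: "d = (p, q)" by (cases d)
  have "p \<noteq> q"
    using d by (auto simp: pq grid_darts_def)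
  then obtain x where x: "x \<in> flap d" "x \<in> flap (grid_opp d)"
    unfolding pq by (metis UnI1 flap.simps grid_opp.simps midpoint_in_open_segment open_segment_commute)
  obtain s m n where *: "\<bar>s\<bar> = 1" "move s m n x \<in> tri"
    by (rule tiles_cover)
  show thesis
  proof
    show "\<bar>s\<bar> = 1" by fact
    show "moved s m n d \<in> tri_pieces"
      using * x d flap_move [of s d x m n] by (auto simp: pieces_def moved_in)
    show "moved s m n (grid_opp d) \<in> tri_pieces"
      using * x d flap_move [of s "grid_opp d" x m n]
        moved_in [of s "grid_opp d" m n] unfolding pieces_def by auto
  qed
qed

text \<open>Gluing steps are moves and so stay in a fibre of H; conversely
  \<open>glue_connected\<close> joins any two pieces of a fibre. Thus the classes are the fibres of
  H on pieces, and the operations are those of X.\<close>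

lemma folded_grid_quotient:
  fixes H :: "complex \<times> complex \<Rightarrow> 'd"
  assumes HX: "H ` grid_darts = X"
    and Hr: "\<And>d. d \<in> grid_darts \<Longrightarrow> H (grid_rot d) = r (H d)"
    and Ho: "\<And>d. d \<in> grid_darts \<Longrightarrow> H (grid_opp d) = o' (H d)"
    and fib: "\<And>d e. d \<in> grid_darts \<Longrightarrow> e \<in> grid_darts \<Longrightarrow>
      H d = H e \<longleftrightarrow> (\<exists>s m n. \<bar>s\<bar> = 1 \<and> e = moved s m n d)"
  obtains cl where "bij_betw cl X (darts (folded_grid A (A + u) (A + v)))"
    "\<And>x. x \<in> X \<Longrightarrow> rot (folded_grid A (A + u) (A + v)) (cl x) = cl (r x)"
    "\<And>x. x \<in> X \<Longrightarrow> opp (folded_grid A (A + u) (A + v)) (cl x) = cl (o' x)"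
proof -
  let ?gl = "glued A (A + u) (A + v)"
  define cl where "cl x = {d \<in> tri_pieces. H d = x}" for x
  have PG: "d \<in> grid_darts" if "d \<in> tri_pieces" for d
    using that by (simp add: pieces_def)
  have moved_H: "H (moved s m n d) = H d" if "\<bar>s\<bar> = 1" "d \<in> grid_darts" for s m n d
    using fib [OF that(2) moved_in [OF that]] that(1) by metis
  have glued_iff: "(d, e) \<in> ?gl \<longleftrightarrow> d \<in> tri_pieces \<and> e \<in> tri_pieces \<and> H d = H e" for d e
  proof
    assume "(d, e) \<in> ?gl"
    then have de: "d \<in> tri_pieces" "e \<in> tri_pieces" "(d, e) \<in> glue\<^sup>*"
      by (auto simp: glued_def)
    from de(3) have "e \<in> grid_darts \<and> H d = H e"
    proof (induction rule: rtrancl_induct)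
      case base
      then show ?case using PG de by simp
    next
      case (step y z)
      then obtain m n where "z = moved (- 1) m n y"
        using glue_step_moved by blast
      then show ?case
        using step.IH moved_H [of "- 1" y m n] moved_in [of "- 1" y m n] by simp
    qed
    with de show "d \<in> tri_pieces \<and> e \<in> tri_pieces \<and> H d = H e"
      by simp
  next
    assume de: "d \<in> tri_pieces \<and> e \<in> tri_pieces \<and> H d = H e"
    then obtain s m n where s: "\<bar>s\<bar> = 1" and e: "e = moved s m n d"
      using fib PG by blast
    have "(d, e) \<in> glue\<^sup>*"
      unfolding e using de s unfolding e by (intro glue_connected) (auto simp: pieces_def)
    then show "(d, e) \<in> ?gl"
      using de by (simp add: glued_def)
  qed
  have cl_H: "?gl `` {d} = cl (H d)" if "d \<in> tri_pieces" for d
    using that by (auto simp: glued_iff cl_def)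
  have ex: "\<exists>d\<in>tri_pieces. H d = x" if x: "x \<in> X" for x
  proof -
    obtain d where d: "d \<in> grid_darts" "H d = x"
      using HX x by blast
    then show ?thesis
      using rot_pieces [OF d(1)] moved_H by metis
  qed
  have rot: "?gl `` (grid_rot ` cl x) = cl (r x)" if x: "x \<in> X" for x
  proof -
    obtain d0 where d0: "d0 \<in> grid_darts" "H d0 = x"
      using HX x by blast
    obtain s m n where smn: "\<bar>s\<bar> = 1" "moved s m n d0 \<in> tri_pieces"
        "moved s m n (grid_rot d0) \<in> tri_pieces"
      using rot_pieces [OF d0(1)] .
    define d where "d = moved s m n d0"
    \<comment> \<open>Rotated members that are not pieces are lost under \<open>glued\<close>; this
      one survives, so the image class is not empty.\<close>
    have d: "d \<in> cl x" "grid_rot d \<in> tri_pieces"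
      using smn d0 moved_H by (auto simp: d_def cl_def moved_rot)
    have Hd: "H (grid_rot e) = r x" if "e \<in> cl x" for e
      using that Hr PG by (auto simp: cl_def)
    show ?thesis
    proof (intro equalityI subsetI)
      fix e assume "e \<in> ?gl `` (grid_rot ` cl x)"
      then obtain e' where e': "e' \<in> cl x" "(grid_rot e', e) \<in> ?gl"
        by blast
      then show "e \<in> cl (r x)"
        using Hd [OF e'(1)] unfolding glued_iff by (simp add: cl_def)
    next
      fix e assume "e \<in> cl (r x)"
      then have "(grid_rot d, e) \<in> ?gl"
        using d Hd [OF d(1)] by (simp add: glued_iff cl_def)
      then show "e \<in> ?gl `` (grid_rot ` cl x)"
        using d by blast
    qed
  qed
  have opp: "?gl `` (grid_opp ` cl x) = cl (o' x)" if x: "x \<in> X" for x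
  proof -
    obtain d0 where d0: "d0 \<in> grid_darts" "H d0 = x"
      using HX x by blast
    obtain s m n where smn: "\<bar>s\<bar> = 1" "moved s m n d0 \<in> tri_pieces"
        "moved s m n (grid_opp d0) \<in> tri_pieces"
      using opp_pieces [OF d0(1)] .
    define d where "d = moved s m n d0"
    have d: "d \<in> cl x" "grid_opp d \<in> tri_pieces"
      using smn d0 moved_H by (auto simp: d_def cl_def moved_opp)
    have Hd: "H (grid_opp e) = o' x" if "e \<in> cl x" for e
      using that Ho PG by (auto simp: cl_def)
    show ?thesis
    proof (intro equalityI subsetI)
      fix e assume "e \<in> ?gl `` (grid_opp ` cl x)"
      then obtain e' where e': "e' \<in> cl x" "(grid_opp e', e) \<in> ?gl"
        by blast
      then show "e \<in> cl (o' x)"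
        using Hd [OF e'(1)] unfolding glued_iff by (simp add: cl_def)
    next
      fix e assume "e \<in> cl (o' x)"
      then have "(grid_opp d, e) \<in> ?gl"
        using d Hd [OF d(1)] by (simp add: glued_iff cl_def)
      then show "e \<in> ?gl `` (grid_opp ` cl x)"
        using d by blast
    qed
  qed
  show thesis
  proof
    have "inj_on cl X"
    proof (rule inj_onI)
      fix x y assume xy: "x \<in> X" "y \<in> X" "cl x = cl y"
      obtain d where "d \<in> tri_pieces" "H d = x"
        using ex xy by blast
      then have "d \<in> cl y"
        using xy(3) by (auto simp: cl_def)
      then show "x = y"
        using \<open>H d = x\<close> by (simp add: cl_def)
    qed
    moreover have "cl ` X = tri_pieces // ?gl"
    proof -
      have "tri_pieces // ?gl = (\<lambda>d. cl (H d)) ` tri_pieces"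
        unfolding quotient_def by (auto simp: cl_H)
      also have "\<dots> = cl ` H ` tri_pieces"
        by (simp only: image_image)
      also have "H ` tri_pieces = X"
      proof
        show "H ` tri_pieces \<subseteq> X"
          unfolding HX [symmetric] by (intro image_mono subsetI PG)
        show "X \<subseteq> H ` tri_pieces"
        proof
          fix x assume "x \<in> X"
          from ex [OF this] show "x \<in> H ` tri_pieces" by (elim bexE) (rule image_eqI, simp_all)
        qed
      qed
      finally show ?thesis by simp
    qed
    ultimately show "bij_betw cl X (darts (folded_grid A (A + u) (A + v)))"
      by (simp add: bij_betw_def folded_grid_def)
    show "\<And>x. x \<in> X \<Longrightarrow> dart_graph.rot (folded_grid A (A + u) (A + v)) (cl x) = cl (r x)"
      by (simp add: folded_grid_def rot)
    show "\<And>x. x \<in> X \<Longrightarrow> dart_graph.opp (folded_grid A (A + u) (A + v)) (cl x) = cl (o' x)"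
      by (simp add: folded_grid_def opp)
  qed
qed

end

section \<open>Reduced bases\<close>

lemma angle_le_pi_half:
  assumes "0 \<le> (P - Q) \<bullet> (R - Q)"
  shows "angle P Q R \<le> pi / 2"
proof -
  let ?y = "((P - Q) \<bullet> (R - Q)) / (norm (P - Q) * norm (R - Q))"
  have "?y \<le> 1"
    using norm_cauchy_schwarz [of "P - Q" "R - Q"] by (auto simp: divide_le_eq_1 zero_less_mult_iff)
  moreover have "0 \<le> ?y"
    using assms by simp
  ultimately show ?thesis
    unfolding angle_def by (intro arccos_le_pi2)
qed

text \<open>The inequalities are the signs of the inner products of the sides meeting at A, A + u
  and A + v, in this order.\<close>

lemma nonobtuse_triangleI:
  assumes "cross u v \<noteq> 0" "0 \<le> u \<bullet> v" "u \<bullet> v \<le> u \<bullet> u" "u \<bullet> v \<le> v \<bullet> v"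
  shows "nonobtuse_triangle A (A + u) (A + v)"
  unfolding nonobtuse_triangle_def using assms
  by (intro conjI not_collinear_if_cross angle_le_pi_half)
     (simp_all add: inner_diff_left inner_diff_right inner_commute)

text \<open>Integrality of squared norms is what provides shortest vectors.\<close>

lemma norm_gridpoint_nat:
  assumes "x \<in> gridpoints"
  shows "(norm x)\<^sup>2 = real (nat \<lfloor>(norm x)\<^sup>2\<rfloor>)"
proof -
  obtain i j where "x = grid_pt i j"
    using assms by (auto simp: gridpoints_eq)
  then have "(norm x)\<^sup>2 = of_int (i * i + i * j + j * j)"
    by (simp only: norm_grid_pt)
  then show ?thesis
    by (metis floor_of_int of_int_0_le_iff of_nat_nat of_int_of_nat_eq zero_le_power2)
qed

lemma gridpoint_norm_minimal:
  assumes "S \<subseteq> gridpoints" "S \<noteq> {}"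
  shows "\<exists>x\<in>S. \<forall>y\<in>S. (norm x)\<^sup>2 \<le> (norm y)\<^sup>2"
proof -
  obtain x where x: "x \<in> S" "\<And>y. y \<in> S \<Longrightarrow> nat \<lfloor>(norm x)\<^sup>2\<rfloor> \<le> nat \<lfloor>(norm y)\<^sup>2\<rfloor>"
    using assms(2) ex_has_least_nat [of "\<lambda>x. x \<in> S" _ "\<lambda>x. nat \<lfloor>(norm x)\<^sup>2\<rfloor>"] by blast
  have "(norm x)\<^sup>2 \<le> (norm y)\<^sup>2" if "y \<in> S" for y
    using x that assms(1) norm_gridpoint_nat by (metis of_nat_mono subset_eq)
  with x show ?thesis by blast
qed

text \<open>Lagrange reduction: u is a shortest nonzero vector, v a shortest one off the line of u,
  with its sign chosen to make the inner product nonnegative. Rounding the coordinates of w leaves a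
  remainder shorter than v, hence on the line of u, and then shorter than u, hence 0.\<close>

lemma reduced_basis:
  assumes L: "L \<subseteq> gridpoints" and diff: "\<And>x y. x \<in> L \<Longrightarrow> y \<in> L \<Longrightarrow> x - y \<in> L"
    and ab: "a \<in> L" "b \<in> L" "cross a b \<noteq> 0"
  obtains u v where "u \<in> L" "v \<in> L" "cross u v \<noteq> 0" "0 \<le> u \<bullet> v" "u \<bullet> v \<le> u \<bullet> u" "u \<bullet> v \<le> v \<bullet> v"
    "\<And>w. w \<in> L \<Longrightarrow> \<exists>m n. w = of_int m * u + of_int n * v"
proof -
  have zero: "0 \<in> L" using diff [OF ab(1) ab(1)] by simp
  have neg: "- x \<in> L" if "x \<in> L" for x using diff [OF zero that] by simp
  have add: "x + y \<in> L" if "x \<in> L" "y \<in> L" for x y using diff [OF that(1) neg [OF that(2)]] by simp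
  have mult: "of_int m * x \<in> L" if "x \<in> L" for m x
    using that by (induction m rule: int_induct [where k = 0]) (simp_all add: zero add diff algebra_simps)
  have "a \<noteq> 0" using ab(3) by (auto simp: cross_def)
  then have "L - {0} \<noteq> {}" "L - {0} \<subseteq> gridpoints" using ab L by auto
  then obtain u where u: "u \<in> L" "u \<noteq> 0" and "\<forall>y\<in>L - {0}. (norm u)\<^sup>2 \<le> (norm y)\<^sup>2"
    using gridpoint_norm_minimal [of "L - {0}"] by auto
  then have umin: "(norm u)\<^sup>2 \<le> (norm y)\<^sup>2" if "y \<in> L" "y \<noteq> 0" for y
    using that by simp
  have "cross u a \<noteq> 0 \<or> cross u b \<noteq> 0"
  proof (rule ccontr)
    assume "\<not> (cross u a \<noteq> 0 \<or> cross u b \<noteq> 0)"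
    \<comment> \<open>Cramer's rule expresses u through a and b; were both coefficients 0, u would
      vanish.\<close>
    moreover have "Re u * cross a b = Re a * cross u b - Re b * cross u a"
        "Im u * cross a b = Im a * cross u b - Im b * cross u a"
      by (simp_all add: cross_def algebra_simps)
    ultimately show False
      using ab(3) u(2) by (auto simp: complex_eq_iff)
  qed
  then have "{x \<in> L. cross u x \<noteq> 0} \<noteq> {}" "{x \<in> L. cross u x \<noteq> 0} \<subseteq> gridpoints"
    using ab L by auto
  then obtain v0 where v0: "v0 \<in> L" "cross u v0 \<noteq> 0"
      and "\<forall>y\<in>{x \<in> L. cross u x \<noteq> 0}. (norm v0)\<^sup>2 \<le> (norm y)\<^sup>2"
    using gridpoint_norm_minimal [of "{x \<in> L. cross u x \<noteq> 0}"] by auto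
  then have v0min: "(norm v0)\<^sup>2 \<le> (norm y)\<^sup>2" if "y \<in> L" "cross u y \<noteq> 0" for y
    using that by simp
  define v where "v = (if 0 \<le> u \<bullet> v0 then v0 else - v0)"
  have v: "v \<in> L" "cross u v \<noteq> 0" "0 \<le> u \<bullet> v"
    using v0 neg by (auto simp: v_def cross_def)
  have vmin: "(norm v)\<^sup>2 \<le> (norm y)\<^sup>2" if "y \<in> L" "cross u y \<noteq> 0" for y
    using v0min that by (auto simp: v_def)
  have "(norm v)\<^sup>2 \<le> (norm (v - u))\<^sup>2"
    using v u diff by (intro vmin) (auto simp: cross_def algebra_simps)
  then have uv: "2 * (u \<bullet> v) \<le> u \<bullet> u"
    by (simp add: power2_norm_eq_inner inner_diff_left inner_diff_right inner_commute)
  have "(norm u)\<^sup>2 \<le> (norm v)\<^sup>2"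
    using v by (intro umin) (auto simp: cross_def)
  then have uv': "u \<bullet> u \<le> v \<bullet> v"
    by (simp add: power2_norm_eq_inner)
  have pos: "0 < u \<bullet> u"
    using u by simp
  show thesis
  proof
    show "u \<in> L" "v \<in> L" "cross u v \<noteq> 0" "0 \<le> u \<bullet> v"
      using u(1) v by simp_all
    show "u \<bullet> v \<le> u \<bullet> u" "u \<bullet> v \<le> v \<bullet> v"
      using uv uv' v(3) by linarith+
    fix w assume w: "w \<in> L"
    \<comment> \<open>Provides the coordinates \<open>sc\<close> and \<open>tc\<close> with respect
      to u, v.\<close>
    interpret folding 0 u v
      by unfold_locales (use v u L in auto)
    define m where "m = round (sc w)"
    define n where "n = round (tc w)"
    define w' where "w' = w - (of_int m * u + of_int n * v)"
    define \<alpha> where "\<alpha> = sc w - of_int m"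
    define \<beta> where "\<beta> = tc w - of_int n"
    have w'L: "w' \<in> L"
      unfolding w'_def by (intro diff add mult w u(1) v(1))
    have w': "w' = \<alpha> *\<^sub>R u + \<beta> *\<^sub>R v"
      unfolding w'_def by (subst coords [of w]) (simp add: \<alpha>_def \<beta>_def scaleR_conv_of_real algebra_simps)
    have \<alpha>: "\<bar>\<alpha>\<bar> \<le> 1 / 2" and \<beta>: "\<bar>\<beta>\<bar> \<le> 1 / 2"
      using of_int_round_abs_le [of "sc w"] of_int_round_abs_le [of "tc w"]
      by (simp_all add: \<alpha>_def \<beta>_def m_def n_def abs_minus_commute)
    have \<alpha>2: "\<alpha>\<^sup>2 \<le> 1 / 4" and \<beta>2: "\<beta>\<^sup>2 \<le> 1 / 4"
      using power_mono [OF \<alpha>, of 2] power_mono [OF \<beta>, of 2] by (simp_all add: power_divide)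
    have "\<alpha> * \<beta> \<le> \<bar>\<alpha>\<bar> * \<bar>\<beta>\<bar>"
      by (metis abs_ge_self abs_mult)
    also have "\<dots> \<le> 1 / 2 * (1 / 2)"
      by (intro mult_mono \<alpha> \<beta>) auto
    finally have \<alpha>\<beta>: "\<alpha> * \<beta> \<le> 1 / 4"
      by simp
    have "(norm w')\<^sup>2 = \<alpha>\<^sup>2 * (u \<bullet> u) + 2 * (\<alpha> * \<beta> * (u \<bullet> v)) + \<beta>\<^sup>2 * (v \<bullet> v)"
      unfolding w' power2_norm_eq_inner
      by (simp add: inner_add_left inner_add_right inner_commute power2_eq_square algebra_simps)
    also have "\<dots> \<le> 1 / 4 * (u \<bullet> u) + 2 * (1 / 4 * (u \<bullet> v)) + 1 / 4 * (v \<bullet> v)"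
      using \<alpha>2 \<beta>2 \<alpha>\<beta> v(3) by (intro add_mono mult_left_mono mult_right_mono) auto
    \<comment> \<open>At most 3/4 of \<open>v \<bullet> v\<close>, because
      \<open>2 * (u \<bullet> v) \<le> u \<bullet> u\<close> and
      \<open>u \<bullet> u \<le> v \<bullet> v\<close>.\<close>
    also have "\<dots> < v \<bullet> v"
      using uv uv' pos by linarith
    finally have lt: "(norm w')\<^sup>2 < (norm v)\<^sup>2"
      by (simp add: power2_norm_eq_inner)
    then have "cross u w' = 0"
      using vmin [OF w'L] by linarith
    moreover have "cross u w' = \<beta> * cross u v"
      by (simp add: w' cross_def algebra_simps)
    ultimately have "\<beta> = 0"
      using v(2) by simp
    then have "(norm w')\<^sup>2 = \<alpha>\<^sup>2 * (u \<bullet> u)"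
      unfolding w' power2_norm_eq_inner by (simp add: power2_eq_square)
    also have "\<dots> \<le> 1 / 4 * (u \<bullet> u)"
      using \<alpha>2 by (intro mult_right_mono) auto
    also have "\<dots> < (norm u)\<^sup>2"
      using pos by (simp add: power2_norm_eq_inner)
    finally have "w' = 0"
      using umin [OF w'L] by linarith
    then show "\<exists>m n. w = of_int m * u + of_int n * v"
      unfolding w'_def by (metis eq_iff_diff_eq_0)
  qed
qed

section \<open>Deck transformations\<close>

definition grid_sym :: "nat \<Rightarrow> complex \<Rightarrow> complex \<times> complex \<Rightarrow> complex \<times> complex" where
  "grid_sym k b = map_prod (\<lambda>x. \<zeta> ^ k * x + b) (\<lambda>x. \<zeta> ^ k * x + b)"

lemma grid_sym_simp: "grid_sym k b (p, q) = (\<zeta> ^ k * p + b, \<zeta> ^ k * q + b)"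
  by (simp add: grid_sym_def)

lemma grid_sym_in: "b \<in> gridpoints \<Longrightarrow> d \<in> grid_darts \<Longrightarrow> grid_sym k b d \<in> grid_darts"
proof -
  assume b: "b \<in> gridpoints" and d: "d \<in> grid_darts"
  have "dist (\<zeta> ^ k * p + b) (\<zeta> ^ k * q + b) = dist p q" for p q
    by (simp add: dist_norm norm_mult norm_power flip: right_diff_distrib)
  then show ?thesis
    using b d by (auto simp: grid_darts_def grid_sym_simp)
qed

lemma grid_sym_rot: "grid_sym k b (grid_rot d) = grid_rot (grid_sym k b d)"
  by (cases d) (simp add: grid_sym_simp apex_def algebra_simps)

lemma grid_sym_opp: "grid_sym k b (grid_opp d) = grid_opp (grid_sym k b d)"
  by (cases d) (simp add: grid_sym_simp)

lemma grid_sym_comp: "grid_sym k b (grid_sym l c d) = grid_sym (k + l) (\<zeta> ^ k * c + b) d"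
  by (cases d) (simp add: grid_sym_simp power_add algebra_simps)

lemma grid_sym_mod: "grid_sym k b = grid_sym (k mod 6) b"
  unfolding grid_sym_def using zeta_power_mod by metis

lemma grid_sym_transitive:
  assumes "d \<in> grid_darts" "e \<in> grid_darts"
  obtains k b where "b \<in> gridpoints" "e = grid_sym k b d"
proof -
  obtain p i where d: "d = (p, p + \<zeta> ^ i)" "p \<in> gridpoints" "i < 6"
    using assms(1) by (auto simp: grid_darts_iff)
  obtain q j where e: "e = (q, q + \<zeta> ^ j)" "q \<in> gridpoints"
    using assms(2) by (auto simp: grid_darts_iff)
  \<comment> \<open>Adding 6 keeps the natural-number difference from being truncated.\<close>
  have "\<zeta> ^ (j + 6 - i) * \<zeta> ^ i = \<zeta> ^ (j + 6)"
    using d(3) by (simp flip: power_add)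
  also have "\<dots> = \<zeta> ^ j"
    by (simp add: power_add zeta_powers)
  finally have "e = grid_sym (j + 6 - i) (q - \<zeta> ^ (j + 6 - i) * p) d"
    by (simp add: d e grid_sym_simp algebra_simps)
  then show thesis
    using d e by (intro that) auto
qed

text \<open>\<open>r2\<close> will exclude rotations of order 3 about gridpoints, and
  \<open>rs\<close> those about centres of grid faces.\<close>

locale grid_cover =
  fixes H :: "complex \<times> complex \<Rightarrow> 'd" and X :: "'d set" and r s :: "'d \<Rightarrow> 'd"
  assumes HX: "H ` grid_darts = X"
    and Hr: "\<And>d. d \<in> grid_darts \<Longrightarrow> H (grid_rot d) = r (H d)"
    and Hs: "\<And>d. d \<in> grid_darts \<Longrightarrow> H (grid_opp d) = s (H d)"
    and r_inj: "inj_on r X" and s_inj: "inj_on s X"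
    and fin: "finite X"
    and r2: "\<And>x. x \<in> X \<Longrightarrow> r (r x) \<noteq> x"
    and rs: "\<And>x. x \<in> X \<Longrightarrow> r x \<noteq> s x"
begin

definition deck :: "nat \<Rightarrow> complex \<Rightarrow> bool" where
  "deck k b \<longleftrightarrow> b \<in> gridpoints \<and> (\<forall>d\<in>grid_darts. H (grid_sym k b d) = H d)"

text \<open>Symmetries of the grid commute with rotation and reversal, and r and s are injective, so
  agreement at one dart spreads to all.\<close>

lemma deckI:
  assumes b: "b \<in> gridpoints" and d: "d \<in> grid_darts" "H (grid_sym k b d) = H d"
  shows "deck k b"
proof -
  have "(H (grid_sym k b d) = H d) = (H (grid_sym k b e) = H e)" if "e \<in> grid_darts" for e
  proof (rule grid_invariant_const [where f = "\<lambda>d. H (grid_sym k b d) = H d"])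
    fix d assume d: "d \<in> grid_darts"
    then have "H d \<in> X" "H (grid_sym k b d) \<in> X"
      using b HX by (auto simp: grid_sym_in)
    then show "(H (grid_sym k b (grid_rot d)) = H (grid_rot d)) = (H (grid_sym k b d) = H d)"
      "(H (grid_sym k b (grid_opp d)) = H (grid_opp d)) = (H (grid_sym k b d) = H d)"
      using d b r_inj s_inj
      by (simp_all add: grid_sym_rot grid_sym_opp grid_sym_in Hr Hs inj_on_eq_iff)
  qed (use d that in auto)
  with d(2) b show ?thesis
    unfolding deck_def by blast
qed

lemma deck_comp: "deck k b \<Longrightarrow> deck l c \<Longrightarrow> deck (k + l) (\<zeta> ^ k * c + b)"
  unfolding deck_def grid_sym_comp [symmetric] by (metis grid_add grid_sym_in grid_zeta_power)

lemma deck_mod: "deck k b \<longleftrightarrow> deck (k mod 6) b"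
  unfolding deck_def using grid_sym_mod by metis

lemma H_in: "d \<in> grid_darts \<Longrightarrow> H d \<in> X"
  using HX by blast

lemma dart_from: "p \<in> gridpoints \<Longrightarrow> (p, p + \<zeta> ^ k) \<in> grid_darts"
  by (auto simp: grid_darts_def dist_norm norm_power)

text \<open>
  A rotation by a third of a full turn is centred at a gridpoint or at the centre of a face of
  the grid; modulo \<open>1 - \<zeta>\<^sup>2\<close>, an element of norm 3, its translation part is \<open>0\<close> or \<open>\<plusminus> 1\<close>.
\<close>

lemma not_deck_2: "\<not> deck 2 b"
proof
  assume deck: "deck 2 b"
  then obtain i j where b: "b = grid_pt i j"
    by (auto simp: deck_def gridpoints_eq)
  \<comment> \<open>The choice of x and z solves \<open>z - \<zeta> ^ 2 * z = b - c\<close>, where c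
    is the remainder of i - j modulo 3.\<close>
  define x where "x = (i - j) div 3"
  define z where "z = grid_pt x (j + x)"
  have z [simp]: "z \<in> gridpoints" by (simp add: z_def)
  have "(i - j) mod 3 \<in> {0, 1, 2}"
    by auto
  then obtain c where c: "c \<in> {0, 1, 2 :: int}" "i - j = 3 * x + c"
    unfolding x_def by (metis mult_div_mod_eq)
  have "\<zeta> ^ 2 * z + b = z + of_int c"
  proof -
    have i: "i = j + 3 * x + c" using c by simp
    show ?thesis
      unfolding z_def b i zeta_powers grid_pt_def by (simp add: algebra_simps zeta_square)
  qed
  with c(1) consider "\<zeta> ^ 2 * z + b = z" | "\<zeta> ^ 2 * z + b = z + 1" | "\<zeta> ^ 2 * z + b = z + 2"
    by auto
  then show False
  proof cases
    case 1
    then have b: "b = z - \<zeta> ^ 2 * z"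
      by (simp add: algebra_simps)
    have "grid_sym 2 b (z, z + \<zeta> ^ 0) = grid_rot (grid_rot (z, z + \<zeta> ^ 0))"
      unfolding b by (simp add: grid_sym_simp apex_def algebra_simps power2_eq_square)
    then have "r (r (H (z, z + \<zeta> ^ 0))) = H (z, z + \<zeta> ^ 0)"
      using deck dart_from [OF z] Hr by (metis deck_def grid_rot_in)
    then show False
      using r2 H_in dart_from [OF z] by blast
  next
    case 2
    then have b: "b = z + 1 - \<zeta> ^ 2 * z"
      by (simp add: algebra_simps)
    have "grid_rot (grid_sym 2 b (z, z + \<zeta> ^ 0)) = grid_opp (z, z + \<zeta> ^ 0)"
      unfolding b by (simp add: grid_sym_simp apex_def algebra_simps zeta_powers zeta_square)
    then have "r (H (z, z + \<zeta> ^ 0)) = s (H (z, z + \<zeta> ^ 0))"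
      using deck dart_from [OF z] Hr Hs by (metis deck_def grid_sym_in)
    then show False
      using rs H_in dart_from [OF z] by blast
  next
    case 3
    then have b: "b = z + 2 - \<zeta> ^ 2 * z"
      by (simp add: algebra_simps)
    \<comment> \<open>The centre is now that of the face with corners z + 1, z + 1 + \<zeta>, z +
      \<zeta>, which lies to the left of the dart from y in direction -1.\<close>
    define y where "y = z + 1 + \<zeta>"
    have y: "y \<in> gridpoints" by (simp add: y_def)
    have "grid_rot (grid_sym 2 b (y, y + \<zeta> ^ 3)) = grid_opp (y, y + \<zeta> ^ 3)"
      unfolding b y_def by (simp add: grid_sym_simp apex_def algebra_simps zeta_powers zeta_square)
    then have "r (H (y, y + \<zeta> ^ 3)) = s (H (y, y + \<zeta> ^ 3))"
      using deck dart_from [OF y] Hr Hs by (metis deck_def grid_sym_in)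
    then show False
      using rs H_in dart_from [OF y] by blast
  qed
qed

text \<open>Squaring turns rotation parts 1 and 4 into 2, and 5 into 4, so \<open>not_deck_2\<close>
  excludes all of them.\<close>

lemma deck_half_turn_or_translation:
  assumes "deck k b"
  shows "k mod 6 = 0 \<or> k mod 6 = 3"
proof -
  have sq: "deck ((l + l) mod 6) (\<zeta> ^ l * c + c)" if "deck l c" for l c
    using deck_comp [OF that that] deck_mod by blast
  have no: "\<not> deck 4 c" "\<not> deck 1 c" for c
    using sq [of 4 c] sq [of 1 c] not_deck_2 by (auto simp: numeral_2_eq_2)
  moreover have "\<not> deck 5 c" for c
    using sq [of 5 c] no by auto
  moreover have "deck (k mod 6) b"
    using assms deck_mod by blast
  moreover have "k mod 6 < 6" by simp
  then have "k mod 6 \<in> {0, 1, 2, 3, 4, 5}" by auto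
  ultimately show ?thesis
    using not_deck_2 by auto
qed

text \<open>By \<open>deckI\<close> one dart suffices; at a dart already translated by y, the
  translation by x - y amounts to the one by x.\<close>

lemma translations_diff:
  assumes "deck 0 x" "deck 0 y"
  shows "deck 0 (x - y)"
proof -
  have xy: "x \<in> gridpoints" "y \<in> gridpoints"
    using assms by (auto simp: deck_def)
  let ?d = "grid_sym 0 y (0, 0 + \<zeta> ^ 0)"
  have d: "(0, 0 + \<zeta> ^ 0) \<in> grid_darts"
    by (rule dart_from) simp
  show ?thesis
  proof (rule deckI)
    show "x - y \<in> gridpoints" "?d \<in> grid_darts"
      using xy d by (auto intro: grid_sym_in)
    have "grid_sym 0 (x - y) ?d = grid_sym 0 x (0, 0 + \<zeta> ^ 0)"
      by (simp add: grid_sym_comp)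
    then show "H (grid_sym 0 (x - y) ?d) = H ?d"
      using assms d unfolding deck_def by metis
  qed
qed

text \<open>Pigeonhole: two multiples of w send a fixed dart to the same element of the finite set
  X.\<close>

lemma ex_translation:
  assumes w: "w \<in> gridpoints"
  obtains n :: nat where "n > 0" "deck 0 (of_nat n * w)"
proof -
  let ?d = "(0, 0 + \<zeta> ^ 0) :: complex \<times> complex"
  have d: "?d \<in> grid_darts"
    by (rule dart_from) simp
  have nw: "of_nat n * w \<in> gridpoints" for n
    using grid_of_int_mult [OF w, of "int n"] by simp
  let ?f = "\<lambda>n::nat. H (grid_sym 0 (of_nat n * w) ?d)"
  have "range ?f \<subseteq> X"
    using H_in grid_sym_in [OF nw d] by blast
  then have "finite (range ?f)"
    using fin finite_subset by blast
  then have "\<not> inj ?f"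
    using finite_imageD by blast
  then obtain i j where ij: "i < j" "?f i = ?f j"
    unfolding inj_def by (metis linorder_neqE_nat)
  have "deck 0 (of_nat (j - i) * w)"
  proof (rule deckI [OF nw])
    show "grid_sym 0 (of_nat i * w) ?d \<in> grid_darts"
      using grid_sym_in [OF nw d] .
    have "of_nat i * w + of_nat (j - i) * w = of_nat j * w"
      using ij by (simp add: of_nat_diff algebra_simps)
    then have "grid_sym 0 (of_nat (j - i) * w) (grid_sym 0 (of_nat i * w) ?d) = grid_sym 0 (of_nat j * w) ?d"
      by (simp add: grid_sym_comp del: of_nat_diff)
    then show "H (grid_sym 0 (of_nat (j - i) * w) (grid_sym 0 (of_nat i * w) ?d)) = ?f i"
      using ij by simp
  qed
  then show thesis
    using ij by (intro that [of "j - i"]) simp_all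
qed

text \<open>One half-turn fixes the whole group: composing any other with it gives a translation.
  Non-obtuseness is stated for every A because the triangle to be chosen on gridpoints may start at
  0 while the folding takes place at an edgepoint c.\<close>

lemma ex_folding:
  assumes half: "deck 3 (2 * c)"
  obtains u v where "u \<in> gridpoints" "v \<in> gridpoints" "cross u v \<noteq> 0"
    "\<And>A. nonobtuse_triangle A (A + u) (A + v)"
    "\<And>d e. d \<in> grid_darts \<Longrightarrow> e \<in> grid_darts \<Longrightarrow>
      H d = H e \<longleftrightarrow> (\<exists>t m n. \<bar>t\<bar> = 1 \<and> e = map_prod (folding.move c u v t m n) (folding.move c u v t m n) d)"
proof -
  obtain i j :: nat where ij: "i > 0" "deck 0 (of_nat i * 1)" "j > 0" "deck 0 (of_nat j * \<zeta>)"
    using ex_translation [OF grid_1] ex_translation [OF grid_z] by metis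
  have "cross (of_nat i * 1) (of_nat j * \<zeta>) \<noteq> 0"
    using ij by (simp add: cross_def zeta_eq)
  moreover have "Collect (deck 0) \<subseteq> gridpoints"
    by (auto simp: deck_def)
  ultimately have "\<exists>u v. deck 0 u \<and> deck 0 v \<and> cross u v \<noteq> 0 \<and> 0 \<le> u \<bullet> v \<and> u \<bullet> v \<le> u \<bullet> u \<and>
      u \<bullet> v \<le> v \<bullet> v \<and> (\<forall>w. deck 0 w \<longrightarrow> (\<exists>m n. w = of_int m * u + of_int n * v))"
    using ij by - (rule reduced_basis [of "Collect (deck 0)" "of_nat i * 1" "of_nat j * \<zeta>"],
      assumption, use translations_diff in auto)
  then obtain u v where uv: "deck 0 u" "deck 0 v" "cross u v \<noteq> 0" "0 \<le> u \<bullet> v" "u \<bullet> v \<le> u \<bullet> u" "u \<bullet> v \<le> v \<bullet> v"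
      and gen: "\<And>w. deck 0 w \<Longrightarrow> \<exists>m n. w = of_int m * u + of_int n * v"
    by blast
  have guv: "u \<in> gridpoints" "v \<in> gridpoints" "2 * c \<in> gridpoints"
    using uv half by (auto simp: deck_def)
  interpret folding c u v
    using uv guv by unfold_locales auto
  have moved_1: "moved 1 m n = grid_sym 0 (of_int m * u + of_int n * v)" for m n
    by (auto simp: move_def grid_sym_def)
  have moved_m1: "moved (- 1) m n = grid_sym 3 (2 * c + (of_int m * u + of_int n * v))" for m n
    by (auto simp: move_def grid_sym_def zeta_powers)
  have d0: "deck 0 0"
    using translations_diff [OF uv(1) uv(1)] by simp
  have neg: "deck 0 (- x)" if "deck 0 x" for x
    using translations_diff [OF d0 that] by simp
  have add: "deck 0 (x + y)" if "deck 0 x" "deck 0 y" for x y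
    using translations_diff [OF that(1) neg [OF that(2)]] by simp
  have mult: "deck 0 (of_int m * x)" if "deck 0 x" for m x
    using that by (induction m rule: int_induct [where k = 0])
      (simp_all add: d0 add translations_diff algebra_simps)
  have lat: "deck 0 (of_int m * u + of_int n * v)" for m n
    by (intro add mult uv)
  have lat3: "deck 3 (2 * c + (of_int m * u + of_int n * v))" for m n
    using deck_comp [OF lat half] by (simp add: add.commute)
  show thesis
  proof
    show "u \<in> gridpoints" "v \<in> gridpoints" "cross u v \<noteq> 0" by fact+
    show "nonobtuse_triangle A (A + u) (A + v)" for A
      using uv by (intro nonobtuse_triangleI)
    fix d e assume de: "d \<in> grid_darts" "e \<in> grid_darts"
    show "H d = H e \<longleftrightarrow> (\<exists>t m n. \<bar>t\<bar> = 1 \<and> e = moved t m n d)"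
    proof
      assume eq: "H d = H e"
      obtain k b where b: "b \<in> gridpoints" and e: "e = grid_sym k b d"
        using grid_sym_transitive [OF de] .
      have deck: "deck k b"
        using eq de e b by (intro deckI [of b d]) auto
      show "\<exists>t m n. \<bar>t\<bar> = 1 \<and> e = moved t m n d"
        using deck_half_turn_or_translation [OF deck]
      proof
        assume k: "k mod 6 = 0"
        then have "deck 0 b"
          using deck deck_mod [of k] by simp
        then obtain m n where "b = of_int m * u + of_int n * v"
          using gen by blast
        then have "e = moved 1 m n d"
          using e k grid_sym_mod [of k b] by (simp add: moved_1)
        then show ?thesis
          by (intro exI [of _ 1] exI [of _ m] exI [of _ n]) simp
      next
        assume k: "k mod 6 = 3"
        then have "deck 3 b"
          using deck deck_mod [of k] by simp
        \<comment> \<open>Here 3 + 3 = 6 is no rotation, and the translation part is b - 2 c since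
          the third power of \<zeta> is -1.\<close>
        from deck_comp [OF this half] have "deck 0 (b - 2 * c)"
          using deck_mod [of 6] by (simp add: zeta_powers)
        then obtain m n where "b - 2 * c = of_int m * u + of_int n * v"
          using gen by blast
        then have "b = 2 * c + (of_int m * u + of_int n * v)"
          by (simp add: algebra_simps)
        then have "e = moved (- 1) m n d"
          using e k grid_sym_mod [of k b] by (simp add: moved_m1)
        then show ?thesis
          by (intro exI [of _ "- 1"] exI [of _ m] exI [of _ n]) simp
      qed
    next
      assume "\<exists>t m n. \<bar>t\<bar> = 1 \<and> e = moved t m n d"
      then obtain t m n where "\<bar>t\<bar> = 1" and e: "e = moved t m n d"
        by blast
      then have "t = 1 \<or> t = - 1" by linarith
      then show "H d = H e"
        using lat [of m n] lat3 [of m n] de unfolding e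
        by (auto simp: moved_1 moved_m1 deck_def)
    qed
  qed
qed

end

section \<open>Fullerenes\<close>

lemma funpow_perm_restrict:
  assumes "bij_betw f D D" "x \<in> D"
  shows "(perm_restrict f D ^^ n) x = (f ^^ n) x" "(f ^^ n) x \<in> D"
proof -
  have "(perm_restrict f D ^^ n) x = (f ^^ n) x \<and> (f ^^ n) x \<in> D"
    using assms by (induction n) (auto simp: perm_restrict_def bij_betw_def)
  then show "(perm_restrict f D ^^ n) x = (f ^^ n) x" "(f ^^ n) x \<in> D"
    by simp_all
qed

text \<open>The maps of a dart graph are arbitrary off its darts, whereas \<open>permutes\<close>
  asks for the identity there.\<close>

lemma perm_restrict_permutes:
  assumes "bij_betw f D D"
  shows "perm_restrict f D permutes D"
proof (rule bij_imp_permutes)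
  show "bij_betw (perm_restrict f D) D D"
    using assms by (subst bij_betw_cong [of D _ f]) (simp_all add: perm_restrict_def)
qed (simp add: perm_restrict_def)

lemma orbit_perm_restrict:
  assumes "bij_betw f D D" "x \<in> D"
  shows "orbit (perm_restrict f D) x = orbit f x"
  unfolding orbit_altdef using funpow_perm_restrict [OF assms] by auto

context
  fixes f :: "'a \<Rightarrow> 'a" and D :: "'a set"
  assumes fin: "finite D" and bij: "bij_betw f D D"
begin

lemma restrict_permutation: "permutation (perm_restrict f D)"
  using perm_restrict_permutes [OF bij] fin permutation_permutes by blast

lemma self_in_orbit: "x \<in> D \<Longrightarrow> x \<in> orbit f x"
  using permutation_self_in_orbit [OF restrict_permutation] orbit_perm_restrict [OF bij] by blast

lemma orbit_card_funpow:
  assumes "x \<in> D"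
  shows "(f ^^ card (orbit f x)) x = x"
    and "0 < k \<Longrightarrow> k < card (orbit f x) \<Longrightarrow> (f ^^ k) x \<noteq> x"
proof -
  have x: "x \<in> orbit f x"
    using self_in_orbit [OF assms] .
  have "card (orbit f x) = funpow_dist1 f x x"
    using card_image [OF inj_on_funpow_dist1 [OF x]] orbit_conv_funpow_dist1 [OF x] by simp
  then show "(f ^^ card (orbit f x)) x = x"
    "0 < k \<Longrightarrow> k < card (orbit f x) \<Longrightarrow> (f ^^ k) x \<noteq> x"
    using funpow_dist1_prop [OF x] funpow_dist1_least [of k f x x] by auto
qed

lemma card_orbits:
  assumes "\<And>x. x \<in> D \<Longrightarrow> card (orbit f x) = k"
  shows "k * card (orbit f ` D) = card D"
proof -
  have sub: "orbit f x \<subseteq> D" if "x \<in> D" for x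
    using that bij by (auto simp: orbit_altdef funpow_perm_restrict)
  have un: "\<Union> (orbit f ` D) = D"
    using sub self_in_orbit by blast
  have "orbit f x = orbit f y" if "x \<in> D" "y \<in> D" "z \<in> orbit f x" "z \<in> orbit f y" for x y z
    using that self_in_orbit by (metis orbit_cyclic_eq3 cyclic_on_orbit' orbit_perm_restrict [OF bij] restrict_permutation)
  then have "k * card (orbit f ` D) = card (\<Union> (orbit f ` D))"
    using fin assms un by (intro card_partition) auto
  then show ?thesis
    by (simp add: un)
qed

end

section \<open>Dart permutations of a fullerene and its cover\<close>

locale fullerene =
  fixes F :: "'d dart_graph"
  assumes fullerene: "fullerene_036 F"
begin

abbreviation "D \<equiv> darts F"
abbreviation "\<phi> \<equiv> face_next F"

lemma plane: "plane_graph F"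
  using fullerene by (simp add: fullerene_036_def)

lemma fin: "finite D" and ne: "D \<noteq> {}" and rot_bij: "bij_betw (rot F) D D"
  and opp_in: "d \<in> D \<Longrightarrow> opp F d \<in> D" and opp_opp: "d \<in> D \<Longrightarrow> opp F (opp F d) = d"
  and conn: "connected_graph F"
  and euler: "int (card (vertices F)) - int (card (full_edges F)) + int (card (faces F)) = 2"
  using plane by (auto simp: plane_graph_def)

lemma rot_in: "d \<in> D \<Longrightarrow> rot F d \<in> D"
  using rot_bij by (auto simp: bij_betw_def)

lemma opp_bij: "bij_betw (opp F) D D"
  by (rule bij_betw_byWitness [where f' = "opp F"]) (auto simp: opp_in opp_opp)

lemma face_bij: "bij_betw \<phi> D D"
proof -
  have "bij_betw (inv_into D (rot F) \<circ> opp F) D D"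
    using opp_bij bij_betw_inv_into [OF rot_bij] by (rule bij_betw_trans)
  then show ?thesis
    by (simp add: face_next_def [abs_def] comp_def)
qed

lemma face_in: "d \<in> D \<Longrightarrow> \<phi> d \<in> D"
  using face_bij by (auto simp: bij_betw_def)

lemma rot_face: "d \<in> D \<Longrightarrow> rot F (\<phi> d) = opp F d"
  unfolding face_next_def using bij_betw_inv_into_right [OF rot_bij] opp_in by blast

lemma rot3: "d \<in> D \<Longrightarrow> rot F (rot F (rot F d)) = d" and rot1: "d \<in> D \<Longrightarrow> rot F d \<noteq> d"
proof -
  assume d: "d \<in> D"
  then have "card (orbit (rot F) d) = 3"
    using fullerene by (auto simp: fullerene_036_def vertices_def)
  then show "rot F (rot F (rot F d)) = d" "rot F d \<noteq> d"
    using orbit_card_funpow(1) [OF fin rot_bij d] orbit_card_funpow(2) [OF fin rot_bij d, of 1] by (auto simp: numeral_3_eq_3)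
qed

lemma card_face: "d \<in> D \<Longrightarrow> card (orbit \<phi> d) = 3 \<or> card (orbit \<phi> d) = 6"
  using fullerene by (auto simp: fullerene_036_def faces_def)

lemma face6: "d \<in> D \<Longrightarrow> \<phi> (\<phi> (\<phi> (\<phi> (\<phi> (\<phi> d))))) = d" and face2: "d \<in> D \<Longrightarrow> \<phi> (\<phi> d) \<noteq> d"
proof -
  assume d: "d \<in> D"
  note * = orbit_card_funpow [OF fin face_bij d]
  show "\<phi> (\<phi> (\<phi> (\<phi> (\<phi> (\<phi> d))))) = d"
    using card_face [OF d] *(1) by (auto simp: eval_nat_numeral)
  show "\<phi> (\<phi> d) \<noteq> d"
    using card_face [OF d] *(2) [of 2] by (auto simp: numeral_2_eq_2)
qed

text \<open>With n darts, only hexagons and no semiedges, Euler's sum would be n/3 - n/2 + n/6 = 0,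
  as on a torus. Planarity enters the proof through this count.\<close>

lemma ex_triangle_or_semiedge: "\<exists>d\<in>D. \<phi> (\<phi> (\<phi> d)) = d \<or> opp F d = d"
proof (rule ccontr)
  assume no: "\<not> (\<exists>d\<in>D. \<phi> (\<phi> (\<phi> d)) = d \<or> opp F d = d)"
  have "card (orbit \<phi> d) = 6" if "d \<in> D" for d
  proof -
    have "card (orbit \<phi> d) \<noteq> 3"
      using orbit_card_funpow(1) [OF fin face_bij that] no that by (auto simp: numeral_3_eq_3)
    then show ?thesis
      using card_face [OF that] by simp
  qed
  then have f: "6 * card (faces F) = card D"
    unfolding faces_def by (rule card_orbits [OF fin face_bij])
  have v: "3 * card (vertices F) = card D"
    unfolding vertices_def using fullerene
    by (intro card_orbits [OF fin rot_bij]) (auto simp: fullerene_036_def vertices_def)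
  have edges: "full_edges F = (\<lambda>d. {d, opp F d}) ` D"
    using no by (auto simp: full_edges_def)
  have "2 * card (full_edges F) = card (\<Union> (full_edges F))"
  proof (rule card_partition)
    show "finite (full_edges F)"
      using fin by (simp add: edges)
    show "finite (\<Union> (full_edges F))"
      using fin by (auto simp: edges)
    show "card c = 2" if c: "c \<in> full_edges F" for c
    proof -
      obtain d where d: "d \<in> D" "c = {d, opp F d}"
        using c by (auto simp: edges)
      then have "opp F d \<noteq> d" using no by auto
      then show ?thesis using d by auto
    qed
    show "c \<inter> c' = {}" if "c \<in> full_edges F" "c' \<in> full_edges F" "c \<noteq> c'" for c c'
      using that by (auto simp: edges opp_opp) (metis opp_opp)+
  qed
  moreover have "\<Union> (full_edges F) = D"
    using opp_in by (auto simp: edges)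
  ultimately have "2 * card (full_edges F) = card D"
    by simp
  with f v euler show False
    by linarith
qed

text \<open>On darts, \<open>\<phi>\<close> after \<open>opp F\<close> inverts \<open>rot F\<close>,
  so degree 3 is the relation (r s)^3 = 1, and face sizes dividing 6 give r^6 = 1. Connectedness
  makes the cover surjective.\<close>

lemma ex_cover:
  obtains H where "grid_cover H D \<phi> (opp F)"
proof -
  obtain x0 where x0: "x0 \<in> D"
    using ne by blast
  let ?r = "perm_restrict \<phi> D" and ?s = "perm_restrict (opp F) D"
  have r6: "?r (?r (?r (?r (?r (?r x))))) = x" for x
    using face6 face_in by (auto simp: perm_restrict_def)
  have s2: "?s (?s x) = x" for x
    using opp_opp opp_in by (auto simp: perm_restrict_def)
  have rs: "?r (?s (?r (?s (?r (?s x))))) = x" for x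
  proof (cases "x \<in> D")
    case True
    have *: "rot F (\<phi> (opp F y)) = y" "\<phi> (opp F y) \<in> D" if "y \<in> D" for y
      using that rot_face opp_in opp_opp face_in by simp_all
    define w where "w = \<phi> (opp F (\<phi> (opp F (\<phi> (opp F x)))))"
    have "rot F (rot F (rot F w)) = x" "w \<in> D"
      using True * by (simp_all add: w_def)
    then have "w = x"
      using rot3 by simp
    then show ?thesis
      using True by (simp add: w_def perm_restrict_def opp_in face_in)
  qed (simp add: perm_restrict_def)
  obtain H where H: "\<And>d. d \<in> grid_darts \<Longrightarrow> H d \<in> D"
    "\<And>d. d \<in> grid_darts \<Longrightarrow> H (grid_rot d) = ?r (H d)"
    "\<And>d. d \<in> grid_darts \<Longrightarrow> H (grid_opp d) = ?s (H d)"
    using grid_covers_total [OF fin perm_restrict_permutes [OF face_bij]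
        perm_restrict_permutes [OF opp_bij] x0 r6 s2 rs] by blast
  have Hr: "H (grid_rot d) = \<phi> (H d)" and Ho: "H (grid_opp d) = opp F (H d)" if "d \<in> grid_darts" for d
    using H that by (simp_all add: perm_restrict_def)
  have "H ` grid_darts = D"
  proof
    show "H ` grid_darts \<subseteq> D"
      using H by blast
    show "D \<subseteq> H ` grid_darts"
    proof
      fix x assume x: "x \<in> D"
      define y where "y = H (grid_dart 0 0 0)"
      have y: "y \<in> H ` grid_darts" "y \<in> D"
        using H(1) by (simp_all add: y_def)
      have "(y, x) \<in> ({(x, rot F x) | x. x \<in> D} \<union> {(x, opp F x) | x. x \<in> D})\<^sup>*"
        using conn x y by (simp add: connected_graph_def)
      then show "x \<in> H ` grid_darts"
      proof (induction rule: rtrancl_induct)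
        case base
        then show ?case using y by simp
      next
        case (step z w)
        then obtain d where d: "d \<in> grid_darts" "z = H d"
          by blast
        have z: "z \<in> D"
          using d H by simp
        consider "w = rot F z" | "w = opp F z"
          using step.hyps(2) by blast
        then show ?case
        proof cases
          case 1
          \<comment> \<open>The fifth iterate is the inverse of \<phi>, and \<open>rot F\<close> is
            \<open>opp F\<close> after that inverse.\<close>
          let ?z = "\<phi> (\<phi> (\<phi> (\<phi> (\<phi> z))))"
          have "rot F (\<phi> ?z) = opp F ?z"
            using z face_in by (intro rot_face) simp
          then have "w = opp F ?z"
            using 1 face6 [OF z] by simp
          also have "\<dots> = H (grid_opp (grid_rot (grid_rot (grid_rot (grid_rot (grid_rot d))))))"
            using d Hr Ho by simp
          finally show ?thesis
            using d by simp
        next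
          case 2
          then have "w = H (grid_opp d)"
            using d Ho by simp
          then show ?thesis
            using d by simp
        qed
      qed
    qed
  qed
  then have "grid_cover H D \<phi> (opp F)"
  proof (unfold_locales)
    \<comment> \<open>Equality would make \<open>rot F\<close> fix \<open>\<phi> x\<close>, a vertex
      of degree 1.\<close>
    show "\<phi> x \<noteq> opp F x" if "x \<in> D" for x
      using that rot_face rot1 face_in by metis
  qed (use Hr Ho face_bij opp_bij fin face2 in \<open>auto simp: bij_betw_def\<close>)
  then show thesis
    by (rule that)
qed

text \<open>
  The double dual of a graph is the graph conjugated by the reversal of darts, hence the map
  \<open>cl \<circ> opp F\<close> below.
\<close>

lemma plane_isomorphic_dualI:
  fixes G :: "'e dart_graph"
  assumes bij: "bij_betw cl D (darts G)"
    and r: "\<And>x. x \<in> D \<Longrightarrow> rot G (cl x) = cl (\<phi> x)"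
    and o: "\<And>x. x \<in> D \<Longrightarrow> opp G (cl x) = cl (opp F x)"
  shows "plane_isomorphic F (dual G)"
proof -
  have inj: "inj_on (rot G) (darts G)"
  proof (rule inj_onI)
    fix a b assume ab: "a \<in> darts G" "b \<in> darts G" "rot G a = rot G b"
    then have "a \<in> cl ` D" "b \<in> cl ` D"
      using bij by (simp_all add: bij_betw_imp_surj_on)
    then obtain x y where xy: "x \<in> D" "y \<in> D" "a = cl x" "b = cl y"
      by blast
    then have "cl (\<phi> x) = cl (\<phi> y)"
      using ab r by simp
    then have "\<phi> x = \<phi> y"
      using xy bij face_in by (auto simp: bij_betw_def inj_on_eq_iff)
    then show "a = b"
      using xy face_bij by (auto simp: bij_betw_def inj_on_eq_iff)
  qed
  show ?thesis
    unfolding plane_isomorphic_def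
  proof (intro exI conjI ballI)
    show "bij_betw (cl \<circ> opp F) D (darts (dual G))"
      using bij_betw_trans [OF opp_bij bij] by (simp add: dual_def)
    fix d assume d: "d \<in> D"
    have "\<phi> (opp F (rot F d)) = d"
    proof -
      have "rot F (\<phi> (opp F (rot F d))) = rot F d"
        using d by (simp add: rot_face opp_in rot_in opp_opp)
      then show ?thesis
        using inj_onD [OF bij_betw_imp_inj_on [OF rot_bij]] d face_in opp_in rot_in by metis
    qed
    then have "rot G (cl (opp F (rot F d))) = opp G (cl (opp F d))"
      using d by (simp add: r o opp_in rot_in opp_opp)
    moreover have "cl (opp F (rot F d)) \<in> darts G"
      using bij d by (auto simp: bij_betw_def opp_in rot_in)
    ultimately show "(cl \<circ> opp F) (rot F d) = rot (dual G) ((cl \<circ> opp F) d)"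
      using inv_into_f_f [OF inj] by (metis comp_apply dart_graph.select_convs(2) dual_def face_next_def)
    show "(cl \<circ> opp F) (opp F d) = opp (dual G) ((cl \<circ> opp F) d)"
      using d by (simp add: dual_def o opp_in)
  qed
qed

end

theorem theorem6:
  fixes F :: "'d dart_graph"
  assumes "fullerene_036 F"
  shows "\<exists>A\<in>gridpoints. \<exists>B\<in>gridpoints. \<exists>C\<in>gridpoints. \<exists>t.
           nonobtuse_triangle A B C \<and>
           (t = 0 \<or> A + t \<in> edgepoints) \<and>
           plane_isomorphic F (dual (folded_grid (A + t) (B + t) (C + t)))"
proof -
  interpret fullerene F
    by unfold_locales (rule assms)
  obtain H where "grid_cover H D \<phi> (opp F)"
    by (rule ex_cover)
  then interpret grid_cover H D \<phi> "opp F" .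
  obtain x where x: "x \<in> D" "\<phi> (\<phi> (\<phi> x)) = x \<or> opp F x = x"
    using ex_triangle_or_semiedge by blast
  obtain p q where pq: "(p, q) \<in> grid_darts" "H (p, q) = x"
    using x(1) HX by (metis image_iff surj_pair)
  have gpq: "p \<in> gridpoints" "q \<in> gridpoints" "dist p q = 1"
    using pq by (auto simp: grid_darts_def)
  have "\<exists>c. deck 3 (2 * c) \<and> (c \<in> gridpoints \<or> c \<in> edgepoints)"
    using x(2)
  proof
    assume tri: "\<phi> (\<phi> (\<phi> x)) = x"
    \<comment> \<open>Three rotations at p are the half-turn about p; in the semiedge case the
      half-turn about the midpoint reverses the dart.\<close>
    have "grid_sym 3 (2 * p) (p, q) = grid_rot (grid_rot (grid_rot (p, q)))"
      by (simp add: grid_sym_simp apex_def zeta_powers flip: mult.assoc)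
         (simp add: zeta_square algebra_simps)
    then have "H (grid_sym 3 (2 * p) (p, q)) = H (p, q)"
      using pq tri Hr by (metis grid_rot_in)
    then have "deck 3 (2 * p)"
      using pq gpq by (intro deckI [of _ "(p, q)"]) (simp_all only: mult_2 grid_add)
    then show ?thesis
      using gpq by blast
  next
    assume semi: "opp F x = x"
    have c: "2 * midpoint p q = p + q"
      by (simp add: midpoint_def scaleR_conv_of_real)
    have "grid_sym 3 (p + q) (p, q) = grid_opp (p, q)"
      by (simp add: grid_sym_simp zeta_powers)
    then have "H (grid_sym 3 (p + q) (p, q)) = H (p, q)"
      using Hs [OF pq(1)] pq semi by simp
    then have "deck 3 (2 * midpoint p q)"
      unfolding c using pq gpq by (intro deckI [of _ "(p, q)"]) simp_all
    moreover have "midpoint p q \<in> edgepoints"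
      using gpq by (auto simp: edgepoints_def)
    ultimately show ?thesis by blast
  qed
  then obtain c where c: "deck 3 (2 * c)" "c \<in> gridpoints \<or> c \<in> edgepoints"
    by blast
  obtain u v where uv: "u \<in> gridpoints" "v \<in> gridpoints" "cross u v \<noteq> 0"
    "\<And>A. nonobtuse_triangle A (A + u) (A + v)"
    "\<And>d e. d \<in> grid_darts \<Longrightarrow> e \<in> grid_darts \<Longrightarrow>
      H d = H e \<longleftrightarrow> (\<exists>t m n. \<bar>t\<bar> = 1 \<and> e = map_prod (folding.move c u v t m n) (folding.move c u v t m n) d)"
    using ex_folding [OF c(1)] by blast
  interpret folding c u v
    using uv c by unfold_locales (auto simp: deck_def)
  obtain cl where "bij_betw cl D (darts (folded_grid c (c + u) (c + v)))"
    "\<And>x. x \<in> D \<Longrightarrow> rot (folded_grid c (c + u) (c + v)) (cl x) = cl (\<phi> x)"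
    "\<And>x. x \<in> D \<Longrightarrow> opp (folded_grid c (c + u) (c + v)) (cl x) = cl (opp F x)"
    using folded_grid_quotient [OF HX Hr Hs uv(5)] by blast
  then have iso: "plane_isomorphic F (dual (folded_grid c (c + u) (c + v)))"
    by (rule plane_isomorphic_dualI)
  show ?thesis
    using c(2)
  proof
    assume "c \<in> gridpoints"
    then show ?thesis
      using uv iso by (intro bexI [of _ c] bexI [of _ "c + u"] bexI [of _ "c + v"] exI [of _ 0]) auto
  next
    assume "c \<in> edgepoints"
    \<comment> \<open>The triangle before translation is 0, u, v, and t = c carries its corner 0 to
      the edgepoint c.\<close>
    then show ?thesis
      using uv(1,2) uv(4) [of 0] iso
      by (intro bexI [of _ 0] bexI [of _ u] bexI [of _ v] exI [of _ c]) (auto simp: add.commute)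
  qed
qed

end
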